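(* Let $d$ be a square-free positive integer such that $E=\mathbb{Q}(\sqrt{-d})$ has class number at least $4$, and let $\mathcal{O}$ be its ring of integers. Let $\mathfrak{P}$ be a non-principal prime ideal of $\mathcal{O}$ and let $p$ be the prime number lying below $\mathfrak{P}$. Suppose $p$ is odd and $p\nmid d$. If $d\equiv 1,2\pmod 4$, let $n$ be the least positive integer with $-d\equiv n^2\pmod p$, and set $C=p(p-1)^2/4+(p-1)n+(d+n^2)/p+2pd$. If $d\equiv 3\pmod 4$, let $n$ be the least positive odd integer with $-d\equiv n^2\pmod p$, and set $C=p(p-1)^2/4+(p-1)n+(d+n^2)/p+p(d+1)/4$. Then for every positive integer $r\geq C$, the unary Hermitian lattice $\mathfrak{P}v$, where $v$ spans a one-dimensional Hermitian space over $E$ with $h(v)=r/p$, is represented by $I_4$.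
   Context: A Hermitian space is a finite-dimensional $E$-vector space with a map $h$ that is $E$-linear in the first argument and satisfies $h(v,w)=\overline{h(w,v)}$; $h(v):=h(v,v)$. $I_4$ is the Hermitian lattice $\mathcal{O}^4$ with $h(x,y)=\sum_{i=1}^4 x_i\overline{y_i}$. A lattice $L$ is represented by $I_4$ if there is an injective $\mathcal{O}$-linear map $L\to I_4$ preserving $h$. *)

theory Defs
  imports Complex_Main "HOL-Computational_Algebra.Polynomial" "HOL-Computational_Algebra.Squarefree"
begin

definition qfield :: "nat \<Rightarrow> complex set" where
  "qfield d = {of_rat a + of_rat b * (\<i> * of_real (sqrt (real d))) | a b. True}"

definition ring_of_integers :: "nat \<Rightarrow> complex set" where
  "ring_of_integers d = {z \<in> qfield d. \<exists>q :: int poly. lead_coeff q = 1 \<and> poly (map_poly of_int q) z = 0}"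

definition is_ideal :: "complex set \<Rightarrow> complex set \<Rightarrow> bool" where
  "is_ideal R I \<longleftrightarrow> I \<subseteq> R \<and> 0 \<in> I \<and> (\<forall>x\<in>I. \<forall>y\<in>I. x + y \<in> I)
      \<and> (\<forall>a\<in>R. \<forall>x\<in>I. a * x \<in> I)"

definition principal_ideal :: "complex set \<Rightarrow> complex set \<Rightarrow> bool" where
  "principal_ideal R I \<longleftrightarrow> (\<exists>\<alpha>\<in>R. I = (\<lambda>x. \<alpha> * x) ` R)"

definition prime_ideal :: "complex set \<Rightarrow> complex set \<Rightarrow> bool" where
  "prime_ideal R I \<longleftrightarrow> is_ideal R I \<and> I \<noteq> {0} \<and> I \<noteq> R
      \<and> (\<forall>a\<in>R. \<forall>b\<in>R. a * b \<in> I \<longrightarrow> a \<in> I \<or> b \<in> I)"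

definition ideal_class_rel :: "complex set \<Rightarrow> (complex set \<times> complex set) set" where
  "ideal_class_rel R = {(I, J). is_ideal R I \<and> I \<noteq> {0} \<and> is_ideal R J \<and> J \<noteq> {0}
      \<and> (\<exists>\<alpha>\<in>R - {0}. \<exists>\<beta>\<in>R - {0}. (\<lambda>x. \<alpha> * x) ` I = (\<lambda>x. \<beta> * x) ` J)}"

definition class_number :: "nat \<Rightarrow> nat" where
  "class_number d = card ({I. is_ideal (ring_of_integers d) I \<and> I \<noteq> {0}}
                          // ideal_class_rel (ring_of_integers d))"

text \<open>The unary Hermitian lattice P v with h(v) = c, i.e. h(xv, yv) = x * cnj y * c for x, y in P,
  is represented by I_4 = R^4: there is an injective R-linear map P v -> R^4 preserving h.
  The element x v of the lattice is parametrised by x in P.\<close>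
definition unary_represented_by_I4 :: "complex set \<Rightarrow> complex set \<Rightarrow> real \<Rightarrow> bool" where
  "unary_represented_by_I4 R P c \<longleftrightarrow>
     (\<exists>f :: complex \<Rightarrow> nat \<Rightarrow> complex.
        (\<forall>x\<in>P. \<forall>i<4. f x i \<in> R)
      \<and> (\<forall>x\<in>P. \<forall>y\<in>P. \<forall>i<4. f (x + y) i = f x i + f y i)
      \<and> (\<forall>a\<in>R. \<forall>x\<in>P. \<forall>i<4. f (a * x) i = a * f x i)
      \<and> (\<forall>x\<in>P. \<forall>y\<in>P. (\<forall>i<4. f x i = f y i) \<longrightarrow> x = y)
      \<and> (\<forall>x\<in>P. \<forall>y\<in>P. (\<Sum>i<4. f x i * cnj (f y i)) = x * cnj y * of_real c))"

end

theory Submission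
  imports Defs "HOL-Number_Theory.Number_Theory"
begin

text \<open>Since \<open>p\<close> splits, \<open>P\<close> is spanned by \<open>p\<close> and \<open>\<pi> = \<nu> + \<surd>-d\<close> (or \<open>\<pi> = (\<nu> + \<surd>-d) / 2\<close> when
  \<open>d \<equiv> 3 (mod 4)\<close>) with \<open>\<nu> = \<plusminus>n\<close>, and \<open>x y\<^sup>* \<in> p \<O>\<close> for all \<open>x, y \<in> P\<close>. Hence \<open>x \<mapsto> (x y\<^sub>i\<^sup>* / p)\<^sub>i\<close> represents
  \<open>P v\<close> as soon as \<open>y\<^sub>0, \<dots>, y\<^sub>3 \<in> P\<close> have norms with sum \<open>p r\<close>. Take \<open>y\<^sub>0 = p a + \<pi>\<close> with
  \<open>\<bar>a\<bar> \<le> (p - 1) / 2\<close> chosen so that \<open>p r - N y\<^sub>0\<close> is divisible by \<open>p\<^sup>2\<close>, and \<open>y\<^sub>1, y\<^sub>2, y\<^sub>3 \<in> p \<O>\<close>. The bound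
  on \<open>r\<close> ensures that the quotient is at least \<open>2 d\<close> (respectively \<open>(d + 1) / 4\<close>), and every such integer
  is a sum of three norms from \<open>\<O>\<close>, because every positive integer congruent to 1 or 2 modulo 4 is a sum of
  three squares.

  For the three squares it suffices to find \<open>N\<close> dividing some \<open>x\<^sup>2 + n\<close> with \<open>N s\<^sup>2 \<equiv> -1 (mod n)\<close>: this gives a
  positive definite unimodular ternary form representing \<open>n\<close>. Instead of a prime \<open>N\<close> obtained from Dirichlet's
  theorem we use a product of primes split in \<open>\<rat>(\<surd>-n)\<close>. If the classes of such products times squares did not
  fill the kernel of the Kronecker character \<open>\<chi>\<close>, some real character \<open>\<psi>\<close> other than 1 and \<open>\<chi>\<close> would be
  trivial on all split primes; this is excluded by the hyperbola method, as in the elementary proof of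
  \<open>L(1, \<chi>) \<noteq> 0\<close>.\<close>

section \<open>Real characters and the hyperbola method\<close>

text \<open>Summation by parts: partial sums are bounded by \<open>B\<close>, and the nonnegative
  decrements of \<open>g\<close> telescope.\<close>

lemma abel_bound:
  fixes c g :: "nat \<Rightarrow> real"
  assumes B: "\<And>v. \<bar>\<Sum>k=u..<v. c k\<bar> \<le> B"
    and dec: "\<And>k. u \<le> k \<Longrightarrow> g (Suc k) \<le> g k" and nonneg: "\<And>k. u \<le> k \<Longrightarrow> 0 \<le> g k"
  shows "\<bar>\<Sum>k=u..<v. c k * g k\<bar> \<le> B * g u"
proof (cases "u \<le> v")
  case False
  have "0 \<le> B" using B[of u] by simp
  then show ?thesis using False nonneg[of u] by simp
next
  case True
  define S where "S = (\<lambda>j. \<Sum>k=u..<j. c k)"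
  have "(\<Sum>k=u..<v. c k * g k) = S v * g v + (\<Sum>k=u..<v. S (Suc k) * (g k - g (Suc k)))
      \<and> \<bar>\<Sum>k=u..<v. S (Suc k) * (g k - g (Suc k))\<bar> \<le> B * (g u - g v)"
    using True
  proof (induction v rule: dec_induct)
    case base
    then show ?case by (simp add: S_def)
  next
    case (step v)
    have "S (Suc v) = S v + c v" using step by (simp add: S_def)
    moreover have "\<bar>S (Suc v) * (g v - g (Suc v))\<bar> \<le> B * (g v - g (Suc v))"
      using B[of "Suc v"] dec[of v] step by (auto simp: S_def abs_mult intro!: mult_right_mono)
    moreover have "(\<Sum>k=u..<Suc v. h k) = (\<Sum>k=u..<v. h k) + h v" for h :: "nat \<Rightarrow> real"
      using step by simp
    ultimately show ?case
      using step.IH abs_triangle_ineq[of "\<Sum>k=u..<v. S (Suc k) * (g k - g (Suc k))" "S (Suc v) * (g v - g (Suc v))"]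
      by (simp only:) (simp add: algebra_simps)
  qed
  moreover have "\<bar>S v * g v\<bar> \<le> B * g v"
    using B[of v] nonneg[OF True] by (auto simp: S_def abs_mult intro!: mult_right_mono)
  ultimately show ?thesis
    using abs_triangle_ineq[of "S v * g v" "\<Sum>k=u..<v. S (Suc k) * (g k - g (Suc k))"]
    by (simp only:) (simp add: algebra_simps)
qed

lemma sum_inverse_sqrt_le: "(\<Sum>k=1..y. 1 / sqrt (real k)) \<le> 2 * sqrt (real y)"
proof (induction y)
  case (Suc y)
  \<comment> \<open>Comparison with a telescoping sum; it reduces to (s - t)^2 >= 0 for consecutive
    square roots.\<close>
  have "1 / sqrt (real (Suc y)) \<le> 2 * sqrt (real (Suc y)) - 2 * sqrt (real y)"
  proof -
    define s t where "s = sqrt (real (Suc y))" and "t = sqrt (real y)"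
    have "s > 0" "s\<^sup>2 - t\<^sup>2 = 1" by (auto simp: s_def t_def)
    moreover have "(s - t)\<^sup>2 \<ge> 0" by simp
    ultimately have "1 \<le> (2 * s - 2 * t) * s" by (simp add: power2_eq_square algebra_simps)
    then show ?thesis using \<open>s > 0\<close> by (simp add: s_def t_def divide_le_eq)
  qed
  then show ?case using Suc by simp
qed auto

text \<open>Both coordinates cannot exceed \<open>y\<close>, so the region is the square together
  with two mirror-image tails.\<close>

lemma hyperbola_region:
  fixes y :: nat
  shows "{(a, b). 1 \<le> a \<and> 1 \<le> b \<and> a * b \<le> y * y} =
    {1..y} \<times> {1..y} \<union> (SIGMA a:{1..y}. {Suc y..y * y div a})
      \<union> prod.swap ` (SIGMA a:{1..y}. {Suc y..y * y div a})"
proof -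
  have div: "b \<le> y * y div a \<longleftrightarrow> a * b \<le> y * y" if "1 \<le> a" for a b
    using that by (simp add: less_eq_div_iff_mult_less_eq mult.commute)
  have "a \<le> y \<or> b \<le> y" if "a * b \<le> y * y" for a b
    using that mult_strict_mono[of y a y b] by (cases "a \<le> y"; cases "b \<le> y") auto
  moreover have "a * b \<le> y * y" if "a \<le> y" "b \<le> y" for a b using that by (rule mult_le_mono)
  ultimately show ?thesis
    by (fastforce simp: div image_iff Suc_le_eq not_less mult.commute)
qed

text \<open>The square gives a product of two sums bounded by \<open>B\<close>. In a tail, Abel
  summation bounds the inner sum by \<open>B / sqrt (y + 1)\<close> and the outer weights add up to
  at most \<open>2 * sqrt y\<close>, so each tail costs \<open>2 * B\<close>, independently of
  \<open>y\<close>.\<close>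

lemma hyperbola_bound:
  fixes \<alpha> \<beta> :: "nat \<Rightarrow> real"
  assumes A: "\<And>u v. \<bar>\<Sum>k=u..<v. \<alpha> k\<bar> \<le> B" and A': "\<And>u v. \<bar>\<Sum>k=u..<v. \<beta> k\<bar> \<le> B"
    and a1: "\<And>k. \<bar>\<alpha> k\<bar> \<le> 1" and b1: "\<And>k. \<bar>\<beta> k\<bar> \<le> 1"
  shows "\<bar>\<Sum>(a, b) \<in> {(a, b). 1 \<le> a \<and> 1 \<le> b \<and> a * b \<le> y * y}.
            (\<alpha> a / sqrt (real a)) * (\<beta> b / sqrt (real b))\<bar> \<le> B * B + 4 * B"
proof -
  define W where "W = (SIGMA a:{1..y}. {Suc y..y * y div a})"
  define F where "F = (\<lambda>a b. (\<alpha> a / sqrt (real a)) * (\<beta> b / sqrt (real b)))"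
  have B0: "B \<ge> 0" using A[of 0 0] by simp
  have fin: "finite W" by (simp add: W_def)
  have abel: "\<bar>\<Sum>k=u..<v. c k / sqrt (real k)\<bar> \<le> B / sqrt (real u)"
    if "\<And>u v. \<bar>\<Sum>k=u..<v. c k\<bar> \<le> B" "u \<ge> 1" for c :: "nat \<Rightarrow> real" and u v
    using abel_bound[where u = u and c = c and B = B and g = "\<lambda>k. 1 / sqrt (real k)" and v = v] that
    by (auto simp: frac_le)
  have tail: "\<bar>\<Sum>a=1..y. (c a / sqrt (real a)) * (\<Sum>b=Suc y..y * y div a. e b / sqrt (real b))\<bar> \<le> 2 * B"
    if c: "\<And>k. \<bar>c k\<bar> \<le> 1" and e: "\<And>u v. \<bar>\<Sum>k=u..<v. e k\<bar> \<le> B" for c e :: "nat \<Rightarrow> real"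
  proof -
    have "\<bar>\<Sum>a=1..y. (c a / sqrt (real a)) * (\<Sum>b=Suc y..y * y div a. e b / sqrt (real b))\<bar>
        \<le> (\<Sum>a=1..y. (1 / sqrt (real a)) * (B / sqrt (real (Suc y))))"
    proof (rule order_trans[OF sum_abs], rule sum_mono)
      fix a
      have "\<bar>c a / sqrt (real a)\<bar> \<le> 1 / sqrt (real a)"
        using c[of a] by (simp add: divide_right_mono)
      then show "\<bar>(c a / sqrt (real a)) * (\<Sum>b=Suc y..y * y div a. e b / sqrt (real b))\<bar>
          \<le> (1 / sqrt (real a)) * (B / sqrt (real (Suc y)))"
        using abel[OF e, of "Suc y" "Suc (y * y div a)"]
        unfolding abs_mult atLeastLessThanSuc_atLeastAtMost by (intro mult_mono) auto
    qed
    also have "\<dots> = (\<Sum>a=1..y. 1 / sqrt (real a)) * (B / sqrt (real (Suc y)))"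
      by (simp only: sum_distrib_right)
    also have "\<dots> \<le> (2 * sqrt (real (Suc y))) * (B / sqrt (real (Suc y)))"
      using sum_inverse_sqrt_le[of y] B0
      by (intro mult_right_mono) (auto intro: order_trans)
    finally show ?thesis by simp
  qed
  have sq: "\<bar>\<Sum>k=1..y. c k / sqrt (real k)\<bar> \<le> B"
    if "\<And>u v. \<bar>\<Sum>k=u..<v. c k\<bar> \<le> B" for c :: "nat \<Rightarrow> real"
    using abel[OF that, of 1 "Suc y"] by (simp add: atLeastLessThanSuc_atLeastAtMost)
  have dis: "({1..y} \<times> {1..y}) \<inter> W = {}" "({1..y} \<times> {1..y} \<union> W) \<inter> prod.swap ` W = {}"
    by (auto simp: W_def)
  have 1: "(\<Sum>(a, b) \<in> {1..y} \<times> {1..y}. F a b) = (\<Sum>a=1..y. \<alpha> a / sqrt (real a)) * (\<Sum>b=1..y. \<beta> b / sqrt (real b))"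
    by (simp add: F_def sum_product sum.cartesian_product)
  have 2: "(\<Sum>(a, b) \<in> W. F a b) = (\<Sum>a=1..y. (\<alpha> a / sqrt (real a)) * (\<Sum>b=Suc y..y * y div a. \<beta> b / sqrt (real b)))"
    unfolding W_def by (subst sum.Sigma[symmetric]) (auto simp: F_def sum_distrib_left)
  have 3: "(\<Sum>(a, b) \<in> prod.swap ` W. F a b) = (\<Sum>a=1..y. (\<beta> a / sqrt (real a)) * (\<Sum>b=Suc y..y * y div a. \<alpha> b / sqrt (real b)))"
    unfolding W_def
    by (subst sum.reindex, force, subst sum_distrib_left, subst sum.Sigma)
       (auto simp: F_def mult.commute intro!: sum.cong)
  have "(\<Sum>(a, b) \<in> {(a, b). 1 \<le> a \<and> 1 \<le> b \<and> a * b \<le> y * y}. F a b) =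
     (\<Sum>(a, b) \<in> {1..y} \<times> {1..y}. F a b) + (\<Sum>(a, b) \<in> W. F a b) + (\<Sum>(a, b) \<in> prod.swap ` W. F a b)"
    unfolding hyperbola_region W_def[symmetric] using fin dis by (simp add: sum.union_disjoint)
  moreover have "\<bar>(\<Sum>(a, b) \<in> {1..y} \<times> {1..y}. F a b)\<bar> \<le> B * B"
    unfolding 1 abs_mult using sq[OF A] sq[OF A'] B0 by (intro mult_mono) auto
  moreover have "\<bar>\<Sum>(a, b) \<in> W. F a b\<bar> \<le> 2 * B" unfolding 2 using a1 A' by (rule tail)
  moreover have "\<bar>\<Sum>(a, b) \<in> prod.swap ` W. F a b\<bar> \<le> 2 * B" unfolding 3 using b1 A by (rule tail)
  ultimately show ?thesis unfolding F_def by linarith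
qed

section \<open>Real characters: bounded partial sums and convolution with 1\<close>

locale real_character =
  fixes M :: nat and \<chi> :: "nat \<Rightarrow> real"
  assumes modulus_pos: "M > 0"
    and mult: "\<chi> (a * b) = \<chi> a * \<chi> b"
    and periodic: "\<chi> (a mod M) = \<chi> a"
    and coprime_values: "coprime a M \<Longrightarrow> \<chi> a = 1 \<or> \<chi> a = -1"
    and zero: "\<not> coprime a M \<Longrightarrow> \<chi> a = 0"
begin

lemma one [simp]: "\<chi> 1 = 1"
  using mult[of 1 1] coprime_values[of 1] by auto

lemma abs_le_1: "\<bar>\<chi> a\<bar> \<le> 1"
  using coprime_values[of a] zero[of a] by (cases "coprime a M") auto

lemma power: "\<chi> (a ^ k) = \<chi> a ^ k"
  using one by (induction k) (auto simp: mult)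

lemma eq_of_cong: "[a = b] (mod M) \<Longrightarrow> \<chi> a = \<chi> b"
  by (metis cong_def periodic)

text \<open>Multiplication by \<open>a\<close> permutes the residues modulo \<open>M\<close> and
  turns the sum into its negative.\<close>

lemma sum_period_zero:
  assumes a: "\<chi> a = -1"
  shows "(\<Sum>k<M. \<chi> k) = 0"
proof -
  have cop: "coprime a M" using zero[of a] a by force
  have inj: "inj_on (\<lambda>k. a * k mod M) {..<M}"
  proof (rule inj_onI)
    fix x y assume "x \<in> {..<M}" "y \<in> {..<M}" "a * x mod M = a * y mod M"
    then show "x = y"
      using cong_mult_lcancel_nat[OF cop] by (simp add: cong_def)
  qed
  have "(\<lambda>k. a * k mod M) ` {..<M} = {..<M}"
    using modulus_pos by (intro endo_inj_surj[OF _ _ inj]) auto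
  then have "(\<Sum>k<M. \<chi> k) = (\<Sum>k<M. \<chi> (a * k mod M))"
    using sum.reindex[OF inj, of \<chi>] by simp
  also have "\<dots> = - (\<Sum>k<M. \<chi> k)" by (simp add: periodic mult a sum_negf)
  finally show ?thesis by simp
qed

text \<open>Full periods cancel wherever they start, which leaves fewer than \<open>M\<close> terms
  of absolute value at most 1.\<close>

lemma sum_interval_le:
  assumes a: "\<chi> a = -1"
  shows "\<bar>\<Sum>k=u..<v. \<chi> k\<bar> \<le> real M"
proof -
  have block: "(\<Sum>k=u..<u + M. \<chi> k) = 0" for u
  proof (induction u)
    case 0
    then show ?case using sum_period_zero[OF a] by (simp add: atLeast0LessThan)
  next
    case (Suc u)
    have "\<chi> (u + M) = \<chi> u" by (rule eq_of_cong) (simp add: cong_def)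
    moreover have "(\<Sum>k=u..<u + M. \<chi> k) = \<chi> u + (\<Sum>k=Suc u..<u + M. \<chi> k)"
      using modulus_pos by (intro sum.atLeast_Suc_lessThan) auto
    moreover have "(\<Sum>k=Suc u..<Suc u + M. \<chi> k) = (\<Sum>k=Suc u..<u + M. \<chi> k) + \<chi> (u + M)"
      using modulus_pos by simp
    ultimately show ?case using Suc by simp
  qed
  show ?thesis
  proof (induction "v - u" arbitrary: u rule: less_induct)
    case less
    show ?case
    proof (cases "v - u < M")
      case True
      have "\<bar>\<Sum>k=u..<v. \<chi> k\<bar> \<le> (\<Sum>k=u..<v. 1)"
        by (rule order_trans[OF sum_abs]) (intro sum_mono abs_le_1)
      then show ?thesis using True by simp
    next
      case False
      then have "u + M \<le> v" using modulus_pos by linarith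
      then have "(\<Sum>k=u..<v. \<chi> k) = (\<Sum>k=u..<u + M. \<chi> k) + (\<Sum>k=u + M..<v. \<chi> k)"
        by (subst sum.atLeastLessThan_concat) auto
      then show ?thesis using less[of "u + M"] False modulus_pos block[of u] by simp
    qed
  qed
qed

end

lemma real_character_mult:
  assumes "real_character M \<psi>" "real_character M \<chi>"
  shows "real_character M (\<lambda>k. \<psi> k * \<chi> k)"
proof -
  interpret a: real_character M \<psi> by fact
  interpret b: real_character M \<chi> by fact
  show ?thesis
  proof
    show "M > 0" by (rule a.modulus_pos)
    fix k l
    show "\<psi> (k * l) * \<chi> (k * l) = \<psi> k * \<chi> k * (\<psi> l * \<chi> l)" by (simp add: a.mult b.mult)
    show "\<psi> (k mod M) * \<chi> (k mod M) = \<psi> k * \<chi> k" by (simp add: a.periodic b.periodic)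
    show "coprime k M \<Longrightarrow> \<psi> k * \<chi> k = 1 \<or> \<psi> k * \<chi> k = -1"
      using a.coprime_values[of k] b.coprime_values[of k] by auto
    show "\<not> coprime k M \<Longrightarrow> \<psi> k * \<chi> k = 0" by (simp add: a.zero)
  qed
qed

context real_character
begin

text \<open>The Dirichlet convolution of 1 and \<open>\<chi>\<close>, whose values are the
  coefficients of zeta(s) L(s, \<chi>).\<close>

definition divsum :: "nat \<Rightarrow> real" where "divsum m = (\<Sum>b | b dvd m. \<chi> b)"

text \<open>The Euler factor at \<open>q\<close> splits off because a divisor of
  \<open>q ^ k * m\<close> is uniquely a power of \<open>q\<close> times a divisor of
  \<open>m\<close>.\<close>

lemma divsum_prime_power_mult:
  assumes q: "prime q" and m: "\<not> q dvd m" "m > 0"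
  shows "divsum (q ^ k * m) = (\<Sum>i\<le>k. \<chi> q ^ i) * divsum m"
proof -
  have cop: "coprime (q ^ i) b" if "b dvd m" for i b
    using q m that by (meson coprime_power_left_iff dvd_trans prime_imp_coprime)
  have bij: "bij_betw (\<lambda>(i, b). q ^ i * b) ({..k} \<times> {b. b dvd m}) {b. b dvd q ^ k * m}"
  proof (rule bij_betwI')
    fix x y assume xy: "x \<in> {..k} \<times> {b. b dvd m}" "y \<in> {..k} \<times> {b. b dvd m}"
    obtain i b j c where [simp]: "x = (i, b)" "y = (j, c)" by fastforce
    have mult_b: "multiplicity q (q ^ i * b) = i" if "b dvd m" for i b
    proof -
      have "\<not> q dvd b" "b \<noteq> 0" using that m by (auto dest: dvd_trans)
      then show ?thesis using q
        by (simp add: prime_elem_multiplicity_mult_distrib not_dvd_imp_multiplicity_0)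
    qed
    show "((case x of (i, b) \<Rightarrow> q ^ i * b) = (case y of (i, b) \<Rightarrow> q ^ i * b)) = (x = y)"
    proof
      assume eq: "(case x of (i, b) \<Rightarrow> q ^ i * b) = (case y of (i, b) \<Rightarrow> q ^ i * b)"
      then have "i = j" using mult_b[of b i] mult_b[of c j] xy by simp
      then show "x = y" using eq q by (simp add: prime_gt_0_nat)
    qed simp
  next
    fix x assume "x \<in> {..k} \<times> {b. b dvd m}"
    then show "(case x of (i, b) \<Rightarrow> q ^ i * b) \<in> {b. b dvd q ^ k * m}"
      by (auto intro!: mult_dvd_mono le_imp_power_dvd)
  next
    fix y assume "y \<in> {b. b dvd q ^ k * m}"
    then obtain a b where "y = a * b" "a dvd q ^ k" "b dvd m"
      using division_decomp[of y "q ^ k" m] by auto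
    moreover then obtain i where "i \<le> k" "a = q ^ i"
      using q by (auto simp: divides_primepow_nat)
    ultimately show "\<exists>x\<in>{..k} \<times> {b. b dvd m}. y = (case x of (i, b) \<Rightarrow> q ^ i * b)" by force
  qed
  have "divsum (q ^ k * m) = (\<Sum>(i, b) \<in> {..k} \<times> {b. b dvd m}. \<chi> (q ^ i * b))"
    unfolding divsum_def by (subst sum.reindex_bij_betw[OF bij, symmetric]) (auto intro!: sum.cong)
  also have "\<dots> = (\<Sum>i\<le>k. \<chi> q ^ i) * divsum m"
    by (simp add: divsum_def sum_product sum.cartesian_product mult power)
  finally show ?thesis .
qed

lemma geometric_values:
  assumes "x = 1 \<or> x = -1 \<or> x = (0::real)"
  shows "(\<Sum>i\<le>k. x ^ i) \<ge> 0" "even k \<Longrightarrow> (\<Sum>i\<le>k. x ^ i) \<ge> 1" "x = -1 \<Longrightarrow> odd k \<Longrightarrow> (\<Sum>i\<le>k. x ^ i) = 0"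
proof -
  have m1: "(\<Sum>i\<le>k. (-1::real) ^ i) = (if even k then 1 else 0)" for k
    by (induction k) auto
  have z: "(\<Sum>i\<le>k. (0::real) ^ i) = 1" by (simp add: power_0_left)
  show "(\<Sum>i\<le>k. x ^ i) \<ge> 0" "even k \<Longrightarrow> (\<Sum>i\<le>k. x ^ i) \<ge> 1"
     "x = -1 \<Longrightarrow> odd k \<Longrightarrow> (\<Sum>i\<le>k. x ^ i) = 0"
    using assms m1[of k] z by auto
qed

lemma value_cases: "\<chi> a = 1 \<or> \<chi> a = -1 \<or> \<chi> a = 0"
  using coprime_values[of a] zero[of a] by blast

text \<open>Induction strips off the full power of one prime \<open>q\<close>. Its factor is
  nonnegative, at least 1 for an even exponent, and zero if \<open>\<chi> q = -1\<close> and the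
  exponent is odd. So if \<open>m\<close> is coprime to \<open>M\<close> and \<open>divsum m\<close>
  is nonzero, primes with \<chi> = -1 occur to even powers, where \<psi> is 1, and
  \<open>good\<close> settles the others.\<close>

lemma divsum_facts:
  assumes \<psi>: "real_character M \<psi>" and good: "\<And>q. prime q \<Longrightarrow> \<chi> q = 1 \<Longrightarrow> \<psi> q = 1"
    and "m > 0"
  shows "divsum m \<ge> 0 \<and> (coprime m M \<longrightarrow> divsum m \<noteq> 0 \<longrightarrow> \<psi> m = 1)
    \<and> ((\<exists>s. m = s ^ 2) \<longrightarrow> divsum m \<ge> 1)"
  using \<open>m > 0\<close>
proof (induction m rule: less_induct)
  case (less m)
  interpret p: real_character M \<psi> by fact
  show ?case
  proof (cases "m = 1")
    case True
    then show ?thesis by (simp add: divsum_def flip: One_nat_def)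
  next
    case False
    then obtain q where q: "prime q" "q dvd m" using prime_factor_nat by blast
    obtain n where n: "m = q ^ multiplicity q m * n" "\<not> q dvd n"
      using multiplicity_decompose'[of m q] q less.prems by (metis less_numeral_extra(3) not_prime_unit)
    define k where "k = multiplicity q m"
    have k0: "k > 0" using q less.prems by (simp add: k_def prime_multiplicity_gt_zero_iff)
    have mk: "m = q ^ k * n" using n by (simp add: k_def)
    have n0: "n > 0" using mk less.prems by (cases n) auto
    have "n < m" using mk k0 n0 q one_less_power[OF prime_gt_1_nat[OF q(1)], of k] by simp
    note IH = less.IH[OF this n0]
    have f: "divsum m = (\<Sum>i\<le>k. \<chi> q ^ i) * divsum n"
      unfolding mk using q(1) n(2) n0 by (rule divsum_prime_power_mult)
    note g = geometric_values[OF value_cases[of q], of k]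
    have 1: "divsum m \<ge> 0" using g IH by (simp add: f)
    have 2: "\<psi> m = 1" if "coprime m M" "divsum m \<noteq> 0"
    proof -
      have cop: "coprime n M" "coprime q M" using that(1) k0 by (auto simp: mk)
      have "\<psi> n = 1" using IH that cop by (auto simp: f)
      moreover have "\<psi> q ^ k = 1"
      proof (cases "\<chi> q = 1")
        case True
        then show ?thesis using good q by simp
      next
        case False
        then have "\<chi> q = -1" using coprime_values[OF cop(2)] by blast
        then have "even k" using g that f by auto
        then show ?thesis using p.coprime_values[OF cop(2)] by (auto elim: evenE)
      qed
      ultimately show ?thesis by (simp add: mk p.mult p.power)
    qed
    have 3: "divsum m \<ge> 1" if "\<exists>s. m = s ^ 2"
    proof -
      from that obtain s where s: "m = s ^ 2" by blast
      \<comment> \<open>A prime has even exponent in a square, and the cofactor \<open>n\<close> is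
        again a square, so the induction hypothesis covers it.\<close>
      have "multiplicity q m = 2 * multiplicity q s"
        using s q less.prems by (simp add: prime_elem_multiplicity_power_distrib)
      then have ek: "even k" by (simp add: k_def)
      then obtain j where j: "k = 2 * j" by (auto elim: evenE)
      have "(q ^ j) ^ 2 dvd s ^ 2" using mk j by (simp add: s flip: power_mult) (simp add: mult.commute)
      then obtain t where t: "s = q ^ j * t" using pow_divides_pow_iff[of 2 "q ^ j" s] by auto
      have "n = t ^ 2" using mk q unfolding s t j by (simp add: power_mult_distrib power_mult[symmetric] mult.commute prime_gt_0_nat)
      then have "divsum n \<ge> 1" using IH by blast
      then show ?thesis unfolding f using g(2)[OF ek] mult_mono[of 1 "\<Sum>i\<le>k. \<chi> q ^ i" 1 "divsum n"] by simp
    qed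
    show ?thesis using 1 2 3 by blast
  qed
qed

end

section \<open>Separating two real characters by a prime\<close>

lemma harmonic_ge_ln: "ln (real J + 1) \<le> (\<Sum>j<J. 1 / (real j + 1))"
proof (induction J)
  case (Suc J)
  have "ln (1 + 1 / (real J + 1)) \<le> 1 / (real J + 1)" by (rule ln_add_one_self_le_self) simp
  moreover have "1 + 1 / (real J + 1) = (real (Suc J) + 1) / (real J + 1)" by (simp add: field_simps)
  ultimately show ?case using Suc by (simp add: ln_div)
qed simp

lemma sum_divisors_eq_sum_pairs:
  fixes G :: "nat \<Rightarrow> nat \<Rightarrow> real"
  shows "(\<Sum>m=1..x. \<Sum>b | b dvd m. G (m div b) b) = (\<Sum>(a, b) \<in> {(a, b). 1 \<le> a \<and> 1 \<le> b \<and> a * b \<le> x}. G a b)"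
proof -
  have "(\<Sum>m=1..x. \<Sum>b | b dvd m. G (m div b) b) = (\<Sum>(m, b) \<in> (SIGMA m:{1..x}. {b. b dvd m}). G (m div b) b)"
    by (subst sum.Sigma) auto
  also have "\<dots> = (\<Sum>(a, b) \<in> {(a, b). 1 \<le> a \<and> 1 \<le> b \<and> a * b \<le> x}. G a b)"
    by (rule sum.reindex_bij_witness[where i = "\<lambda>(a, b). (a * b, b)" and j = "\<lambda>(m, b). (m div b, b)"])
       (auto simp: Suc_le_eq div_greater_zero_iff dvd_imp_le dvd_pos_nat)
  finally show ?thesis .
qed

text \<open>If no such prime existed, then \<open>\<psi>\<close> would be 1 wherever \<open>1 * \<chi>\<close> is nonzero, so that the
  nonnegative function \<open>\<psi> \<cdot> (1 * \<chi>)\<close>, which is at least 1 on the squares of all \<open>k \<equiv> 1\<close>, would have an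
  unbounded sum with weights \<open>1 / \<surd>m\<close>. But it is the convolution of the two nontrivial characters
  \<open>\<psi>\<close> and \<open>\<psi>\<chi>\<close>, for which the hyperbola method bounds that sum.\<close>
lemma exists_separating_prime:
  assumes \<chi>: "real_character M \<chi>" and \<psi>: "real_character M \<psi>" and a: "\<chi> a = 1" "\<psi> a = -1"
  shows "\<exists>q. prime q \<and> \<chi> q = 1 \<and> \<psi> q \<noteq> 1"
proof (rule ccontr)
  assume "\<not> ?thesis"
  then have good: "\<And>q. prime q \<Longrightarrow> \<chi> q = 1 \<Longrightarrow> \<psi> q = 1" by blast
  interpret x: real_character M \<chi> by fact
  interpret p: real_character M \<psi> by fact
  interpret f: real_character M "\<lambda>k. \<psi> k * \<chi> k" by (rule real_character_mult[OF \<psi> \<chi>])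
  define t where "t = (\<lambda>m. \<psi> m * x.divsum m / sqrt (real m))"
  \<comment> \<open>Complete multiplicativity of \<psi> exhibits \<open>t\<close> as the weighted
    convolution of \<psi> and \<psi>\<chi>.\<close>
  have t_eq: "t m = (\<Sum>b | b dvd m. (\<psi> (m div b) / sqrt (real (m div b))) * (\<psi> b * \<chi> b / sqrt (real b)))"
    if "m \<ge> 1" for m
  proof -
    have "(\<psi> (m div b) / sqrt (real (m div b))) * (\<psi> b * \<chi> b / sqrt (real b)) = \<psi> m * \<chi> b / sqrt (real m)"
      if "b dvd m" for b
    proof -
      have "\<psi> m = \<psi> (m div b) * \<psi> b" "sqrt (real m) = sqrt (real (m div b)) * sqrt (real b)"
        using that by (simp_all flip: p.mult real_sqrt_mult of_nat_mult)
      then show ?thesis by simp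
    qed
    then show ?thesis
      by (simp add: t_def x.divsum_def sum_distrib_left sum_divide_distrib)
  qed
  have bound: "\<bar>\<Sum>m=1..y*y. t m\<bar> \<le> real M * real M + 4 * real M" for y
  proof -
    have "(\<Sum>m=1..y*y. t m) = (\<Sum>m=1..y*y. \<Sum>b | b dvd m. (\<psi> (m div b) / sqrt (real (m div b))) * (\<psi> b * \<chi> b / sqrt (real b)))"
      using t_eq by (intro sum.cong) auto
    also have "\<dots> = (\<Sum>(a, b) \<in> {(a, b). 1 \<le> a \<and> 1 \<le> b \<and> a * b \<le> y * y}. (\<psi> a / sqrt (real a)) * (\<psi> b * \<chi> b / sqrt (real b)))"
      by (rule sum_divisors_eq_sum_pairs)
    also have "\<bar>\<dots>\<bar> \<le> real M * real M + 4 * real M"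
      \<comment> \<open>Both characters take the value -1 at \<open>a\<close>, since
        \<open>\<chi> a = 1\<close>; hence their sums over intervals are bounded.\<close>
      by (rule hyperbola_bound) (use a in \<open>auto intro!: p.sum_interval_le[of a] f.sum_interval_le[of a] p.abs_le_1 f.abs_le_1\<close>)
    finally show ?thesis .
  qed
  have nonneg: "t m \<ge> 0" if "m \<ge> 1" for m
    using x.divsum_facts[OF \<psi> good, of m] that p.zero[of m] by (cases "coprime m M") (auto simp: t_def)
  \<comment> \<open>The squares of \<open>1 + M * j\<close> alone contribute a multiple of the
    harmonic sum: \<psi> is 1 there, \<open>divsum\<close> is at least 1, and the weight is 1 / (1 +
    M j).\<close>
  have big: "ln (real J + 1) / real M \<le> real M * real M + 4 * real M" for J
  proof -
    define y where "y = 1 + M * J"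
    define K where "K = (\<lambda>j. (1 + M * j) * (1 + M * j)) ` {..<J}"
    have inj: "inj_on (\<lambda>j. (1 + M * j) * (1 + M * j)) {..<J}"
      using x.modulus_pos by (auto simp: inj_on_def simp flip: power2_eq_square)
    have "1 / (real j + 1) / real M \<le> t ((1 + M * j) * (1 + M * j))" for j
    proof -
      define k where "k = 1 + M * j"
      have "\<psi> (1 + M * j) = 1" using p.eq_of_cong[of "1 + M * j" 1] p.one by (simp only: cong_def mod_mult_self2)
      moreover have "x.divsum ((1 + M * j) * (1 + M * j)) \<ge> 1"
        using x.divsum_facts[OF \<psi> good, of "(1 + M * j)\<^sup>2"] by (simp add: power2_eq_square del: mult_Suc mult_Suc_right) blast
      moreover have "real (1 + M * j) \<le> real M * (real j + 1)"
        using x.modulus_pos by (simp add: algebra_simps)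
      ultimately have "1 / (real M * (real j + 1)) \<le> 1 * x.divsum (k * k) / real k" "\<psi> k = 1"
        using x.modulus_pos unfolding k_def[symmetric] by (auto intro!: frac_le add_pos_nonneg simp: k_def)
      then show ?thesis unfolding t_def k_def[symmetric] by (simp add: p.mult mult.commute)
    qed
    then have "(\<Sum>j<J. 1 / (real j + 1)) / real M \<le> (\<Sum>j<J. t ((1 + M * j) * (1 + M * j)))"
      by (auto simp: sum_divide_distrib intro!: sum_mono)
    also have "\<dots> = (\<Sum>m\<in>K. t m)" unfolding K_def by (subst sum.reindex[OF inj]) simp
    also have "\<dots> \<le> (\<Sum>m=1..y*y. t m)"
    proof (rule sum_mono2)
      show "K \<subseteq> {1..y*y}"
      proof
        fix m assume "m \<in> K"
        then obtain j where j: "j < J" "m = (1 + M * j) * (1 + M * j)" by (auto simp: K_def)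
        then have "1 + M * j \<le> y" by (simp add: y_def)
        then show "m \<in> {1..y*y}" unfolding j(2) using mult_le_mono[of "1 + M * j" y "1 + M * j" y] by simp
      qed
    qed (use nonneg in auto)
    also have "\<dots> \<le> real M * real M + 4 * real M" using bound[of y] by linarith
    finally show ?thesis
      using harmonic_ge_ln[of J] x.modulus_pos by (smt (verit) divide_right_mono of_nat_0_le_iff)
  qed
  define L where "L = real M * (real M * real M + 4 * real M) + 1"
  have "ln (real (nat \<lceil>exp L\<rceil>) + 1) \<ge> L"
    by (subst ln_ge_iff) linarith+
  moreover have "ln (real (nat \<lceil>exp L\<rceil>) + 1) \<le> L - 1"
    using big[of "nat \<lceil>exp L\<rceil>"] x.modulus_pos by (simp add: L_def divide_le_eq mult.commute)
  ultimately show False by simp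
qed

text \<open>Otherwise a maximal subgroup of units containing the squares and the split primes but not \<open>a\<close> has index 2,
  and its quadratic character separates \<open>a\<close> from all split primes.\<close>
lemma exists_split_times_square:
  assumes \<chi>: "real_character M \<chi>" and a: "\<chi> a = 1"
  shows "\<exists>N s. N > 0 \<and> (\<forall>q. prime q \<longrightarrow> q dvd N \<longrightarrow> \<chi> q = 1) \<and> [N * s\<^sup>2 = a] (mod M)"
proof (rule ccontr)
  assume contra: "\<not> ?thesis"
  interpret x: real_character M \<chi> by fact
  define good where "good = (\<lambda>N. N > 0 \<and> (\<forall>q. prime q \<longrightarrow> q dvd N \<longrightarrow> \<chi> q = 1))"
  define H where "H = {N * s\<^sup>2 mod M | N s. good N \<and> coprime s M}"
  \<comment> \<open>Closure under multiplication yields subgroups here: the inverse of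
    \<open>y\<close> is \<open>y\<close> times the square of its inverse, and squares of units lie
    in \<open>H\<close>.\<close>
  define F where "F = {K. K \<subseteq> {x. x < M \<and> coprime x M} \<and> H \<subseteq> K \<and> (\<forall>x\<in>K. \<forall>y\<in>K. x * y mod M \<in> K) \<and> a mod M \<notin> K}"
  have coprime_a: "coprime a M" using a x.zero[of a] by force
  have good_coprime: "coprime N M" if "good N" for N
  proof (rule ccontr)
    assume "\<not> coprime N M"
    then obtain q where "prime q" "q dvd N" "q dvd M"
      using that by (metis coprime_iff_gcd_eq_1 gcd_greatest_iff prime_factor_nat)
    moreover then have "\<not> coprime q M" by (metis coprime_absorb_left not_prime_unit)
    ultimately show False using that x.zero[of q] by (auto simp: good_def)
  qed
  have good_mult: "good (N * N')" if "good N" "good N'" for N N'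
    using that by (auto simp: good_def prime_dvd_mult_iff)
  have "finite F"
    by (rule finite_subset[of _ "Pow {..<M}"]) (auto simp: F_def)
  moreover have "H \<in> F"
  proof -
    have "x * y mod M \<in> H" if xy: "x \<in> H" "y \<in> H" for x y
    proof -
      obtain N s N' s' where h: "x = N * s\<^sup>2 mod M" "y = N' * s'\<^sup>2 mod M" "good N" "good N'" "coprime s M" "coprime s' M"
        using xy by (auto simp: H_def)
      then have "x * y mod M = (N * N') * (s * s')\<^sup>2 mod M"
        by (simp add: mod_mult_eq power_mult_distrib mult_ac)
      moreover have "good (N * N')" "coprime (s * s') M" using h good_mult by auto
      ultimately show ?thesis unfolding H_def by blast
    qed
    moreover have "a mod M \<notin> H"
    proof
      assume "a mod M \<in> H"
      then obtain N s where "a mod M = N * s\<^sup>2 mod M" "good N" by (auto simp: H_def)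
      then show False using contra unfolding good_def cong_def by metis
    qed
    ultimately show ?thesis
      using x.modulus_pos good_coprime by (auto simp: F_def H_def)
  qed
  ultimately obtain K where K: "K \<in> F" "\<And>K'. K' \<in> F \<Longrightarrow> K \<subseteq> K' \<Longrightarrow> K' = K"
    using finite_has_maximal[of F] by (metis empty_iff)
  define k where "k = (\<lambda>x. x mod M \<in> K)"
  have k_mult: "k (x * y)" if "k x" "k y" for x y
    using that K(1) by (auto simp: k_def F_def) (metis mod_mult_eq)
  have k_cong: "k x \<longleftrightarrow> k y" if "[x = y] (mod M)" for x y
    using that by (simp add: k_def cong_def)
  have k_H: "k (N * s\<^sup>2)" if "good N" "coprime s M" for N s
    using K(1) that by (auto simp: k_def F_def H_def)
  have k_sq: "k (s\<^sup>2)" if "coprime s M" for s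
    using k_H[of 1 s] that by (simp add: good_def)
  have k_coprime: "coprime x M" if "k x" for x
    using that K(1) by (auto simp: k_def F_def)
  have k_cancel: "k x" if xy: "k (x * y)" and y: "k y" for x y
  proof -
    obtain y' where y': "[y * y' = 1] (mod M)"
      using cong_solve_coprime_nat[OF k_coprime[OF y]] by auto
    then have "coprime y' M"
      by (auto simp: coprime_iff_invertible_nat mult.commute)
    then have "k (x * y * y * y'\<^sup>2)" by (intro k_mult xy y k_sq)
    moreover have "[x * (y * y')\<^sup>2 = x * 1\<^sup>2] (mod M)"
      by (intro cong_mult cong_pow y' cong_refl)
    ultimately show ?thesis using k_cong by (simp add: power2_eq_square mult_ac)
  qed
  \<comment> \<open>The union of \<open>K\<close> and its coset by \<open>b\<close> is closed,
    because \<open>b * b\<close> lies in \<open>K\<close>, so by maximality it contains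
    \<open>a\<close>. From a = b u it follows that a b = b^2 u lies in \<open>K\<close>.\<close>
  have k_a: "k (a * b)" if b: "coprime b M" "\<not> k b" for b
  proof -
    define K' where "K' = K \<union> {b * x mod M | x. x \<in> K}"
    have bb: "k (b * b)" using k_sq[OF b(1)] by (simp add: power2_eq_square)
    have mem: "z \<in> K' \<longleftrightarrow> z < M \<and> (k z \<or> (\<exists>x. k x \<and> [z = b * x] (mod M)))" for z
    proof -
      have K: "x \<in> K \<longleftrightarrow> x < M \<and> k x" for x using K(1) by (auto simp: k_def F_def)
      have "(\<exists>x\<in>K. z = b * x mod M) \<longleftrightarrow> z < M \<and> (\<exists>x. k x \<and> [z = b * x] (mod M))"
      proof
        assume "\<exists>x\<in>K. z = b * x mod M"
        then show "z < M \<and> (\<exists>x. k x \<and> [z = b * x] (mod M))"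
          using x.modulus_pos by (auto simp: K cong_def)
      next
        assume "z < M \<and> (\<exists>x. k x \<and> [z = b * x] (mod M))"
        then obtain x where "z = b * x mod M" "k x" by (auto simp: cong_def)
        moreover then have "x mod M \<in> K" by (simp add: k_def)
        ultimately show "\<exists>x\<in>K. z = b * x mod M" by (metis mod_mult_right_eq)
      qed
      then show ?thesis using K by (auto simp: K'_def)
    qed
    have "b mod M \<in> K'" unfolding mem using x.modulus_pos k_sq[of 1]
      by (auto simp: cong_def intro!: exI[of _ 1])
    moreover have "b mod M \<notin> K" using b by (simp add: k_def)
    ultimately have "K' \<notin> F" using K(2)[of K'] by (auto simp: K'_def)
    moreover have "x * y mod M \<in> K'" if xy: "x \<in> K'" "y \<in> K'" for x y
    proof -
      have m: "k (x * y mod M) \<longleftrightarrow> k (x * y)" by (simp add: k_def)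
      consider "k x" "k y" | u where "k x" "k u" "[y = b * u] (mod M)"
        | u where "k y" "k u" "[x = b * u] (mod M)"
        | u v where "k u" "k v" "[x = b * u] (mod M)" "[y = b * v] (mod M)"
        using xy unfolding mem by blast
      then have "k (x * y) \<or> (\<exists>w. k w \<and> [x * y = b * w] (mod M))"
      proof cases
        case 1
        then show ?thesis by (simp add: k_mult)
      next
        case (2 u)
        then have "[x * y = b * (x * u)] (mod M)" using cong_mult[OF cong_refl[of x] 2(3)] by (simp add: mult_ac)
        then show ?thesis using k_mult[of x u] 2 by blast
      next
        case (3 u)
        then have "[x * y = b * (y * u)] (mod M)" using cong_mult[OF 3(3) cong_refl[of y]] by (simp add: mult_ac)
        then show ?thesis using k_mult[of y u] 3 by blast
      next
        case (4 u v)
        then have "[x * y = (b * b) * (u * v)] (mod M)" using cong_mult[OF 4(3,4)] by (simp add: mult_ac)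
        then show ?thesis using k_cong k_mult[OF bb k_mult[of u v]] 4 by blast
      qed
      then show ?thesis unfolding mem m using x.modulus_pos by (auto simp: cong_def)
    qed
    moreover have "K' \<subseteq> {x. x < M \<and> coprime x M}"
      using K(1) b x.modulus_pos by (auto simp: K'_def F_def)
    moreover have "H \<subseteq> K'" using K(1) by (auto simp: K'_def F_def)
    ultimately have "a mod M \<in> K'" by (auto simp: F_def)
    moreover have "\<not> k (a mod M)" using K(1) by (auto simp: k_def F_def)
    ultimately obtain u where u: "k u" "[a = b * u] (mod M)"
      unfolding mem by (auto simp: cong_def)
    then have "[a * b = (b * b) * u] (mod M)" using cong_mult[OF u(2) cong_refl[of b]] by (simp add: mult_ac)
    then show ?thesis using k_cong k_mult[OF bb u(1)] by blast
  qed
  define \<psi> :: "nat \<Rightarrow> real" where "\<psi> = (\<lambda>x. if coprime x M then if k x then 1 else -1 else 0)"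
  have "real_character M \<psi>"
  proof
    show "M > 0" by (rule x.modulus_pos)
    fix u v
    have "k (u * v) \<longleftrightarrow> (k u \<longleftrightarrow> k v)" if c: "coprime u M" "coprime v M"
    proof (cases "k u"; cases "k v")
      assume "\<not> k u" "\<not> k v"
      \<comment> \<open>Elements outside \<open>K\<close> all lie in the coset of \<open>a\<close>;
        the surplus factor a^2 is then cancelled.\<close>
      then have "k ((a * u) * (a * v))" using k_mult k_a c by blast
      then have "k (u * v * a\<^sup>2)" by (simp add: power2_eq_square mult_ac)
      then show ?thesis using k_cancel[OF _ k_sq[OF coprime_a]] \<open>\<not> k u\<close> \<open>\<not> k v\<close> by blast
    qed (use k_mult k_cancel[of u v] k_cancel[of v u] in \<open>auto simp: mult.commute\<close>)
    then show "\<psi> (u * v) = \<psi> u * \<psi> v" by (auto simp: \<psi>_def)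
    show "\<psi> (u mod M) = \<psi> u" using x.modulus_pos by (simp add: \<psi>_def k_def coprime_mod_left_iff)
  qed (auto simp: \<psi>_def)
  moreover have "\<psi> a = -1"
    using coprime_a K(1) by (auto simp: \<psi>_def k_def F_def)
  ultimately obtain q where q: "prime q" "\<chi> q = 1" "\<psi> q \<noteq> 1"
    using exists_separating_prime[OF \<chi> _ a] by blast
  \<comment> \<open>The separating prime is itself an admissible \<open>N\<close> with s = 1, hence
    lies in \<open>K\<close>.\<close>
  then have "good q" by (auto simp: good_def prime_gt_0_nat dest: primes_dvd_imp_eq)
  then show False using k_H[of q 1] q good_coprime[of q] by (auto simp: \<psi>_def)
qed

section \<open>Legendre symbols\<close>

lemma Legendre_values: "Legendre a p = 0 \<or> Legendre a p = 1 \<or> Legendre a p = -1"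
  by (simp add: Legendre_def)

text \<open>Two values among -1, 0, 1 differ by at most 2, which is less than \<open>p\<close>; this
  turns Euler's congruences into equalities.\<close>

lemma sign_eq_of_cong:
  fixes x y :: int
  assumes "x = 0 \<or> x = 1 \<or> x = -1" "y = 0 \<or> y = 1 \<or> y = -1" "[x = y] (mod int p)" "p > 2"
  shows "x = y"
proof (rule ccontr)
  assume "x \<noteq> y"
  moreover have "int p dvd x - y" using assms(3) by (simp add: cong_iff_dvd_diff)
  ultimately have "int p \<le> \<bar>x - y\<bar>" by (intro zdvd_imp_le) (auto simp: dvd_abs_iff)
  then show False using assms by auto
qed

lemma Legendre_mult:
  assumes "prime p" "p > 2"
  shows "Legendre (a * b) (int p) = Legendre a (int p) * Legendre b (int p)"
proof (rule sign_eq_of_cong)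
  have "[Legendre (a * b) p = a ^ ((p - 1) div 2) * b ^ ((p - 1) div 2)] (mod p)"
    using euler_criterion[OF assms, of "a * b"] by (simp add: power_mult_distrib)
  moreover have "[a ^ ((p - 1) div 2) * b ^ ((p - 1) div 2) = Legendre a p * Legendre b p] (mod p)"
    by (intro cong_mult cong_sym[OF euler_criterion] assms)
  ultimately show "[Legendre (a * b) (int p) = Legendre a (int p) * Legendre b (int p)] (mod int p)" by (rule cong_trans)
qed (use Legendre_values[of a p] Legendre_values[of b p] Legendre_values[of "a * b" p] assms in auto)

lemma Legendre_cong:
  assumes "[a = b] (mod p)"
  shows "Legendre a p = Legendre b p"
proof -
  have "[y = a] (mod p) \<longleftrightarrow> [y = b] (mod p)" for y using assms by (simp add: cong_def)
  moreover have "[a = 0] (mod p) \<longleftrightarrow> [b = 0] (mod p)" using assms by (simp add: cong_def)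
  ultimately show ?thesis by (simp add: Legendre_def QuadRes_def)
qed

lemma Legendre_prod:
  assumes "prime p" "p > 2" "finite S"
  shows "Legendre (\<Prod>x\<in>S. f x) (int p) = (\<Prod>x\<in>S. Legendre (f x) (int p))"
  using assms(3)
proof (induction S rule: finite_induct)
  case empty
  have "[1 \<noteq> 0] (mod int p)" using assms by (auto simp: cong_def)
  moreover have "QuadRes p 1" unfolding QuadRes_def by (intro exI[of _ 1]) (simp add: cong_def)
  ultimately show ?case by (simp add: Legendre_def)
qed (simp add: Legendre_mult assms)

text \<open>On odd arguments this is the nontrivial character modulo 4; even arguments get the
  default value -1, so multiplicativity is claimed for odd ones only.\<close>

definition quartic_sign :: "nat \<Rightarrow> int" where
  "quartic_sign m = (if m mod 4 = 1 then 1 else -1)"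

lemma odd_mod_4: "odd (m::nat) \<Longrightarrow> m mod 4 = 1 \<or> m mod 4 = 3"
  by presburger

lemma quartic_sign_mult:
  assumes "odd a" "odd b"
  shows "quartic_sign (a * b) = quartic_sign a * quartic_sign b"
proof -
  have "a * b mod 4 = (a mod 4) * (b mod 4) mod 4" by (simp add: mod_mult_eq)
  then show ?thesis using odd_mod_4[OF assms(1)] odd_mod_4[OF assms(2)] by (auto simp: quartic_sign_def)
qed

lemma quartic_sign_prod:
  assumes "finite S" "\<And>p. p \<in> S \<Longrightarrow> odd p"
  shows "quartic_sign (\<Prod>S) = (\<Prod>p\<in>S. quartic_sign p)"
  using assms
proof (induction S rule: finite_induct)
  case empty
  then show ?case by (simp add: quartic_sign_def)
next
  case (insert x S)
  have "odd (\<Prod>S)" using insert by (metis even_prod_iff insertCI)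
  then show ?case using insert by (simp add: quartic_sign_mult)
qed

lemma minus_one_power_half:
  assumes "odd p"
  shows "(-1::int) ^ ((p - 1) div 2) = quartic_sign p"
proof -
  have "even ((p - 1) div 2) \<longleftrightarrow> p mod 4 = 1" using assms by presburger
  then show ?thesis by (auto simp: quartic_sign_def)
qed

lemma Legendre_minus_one:
  assumes "prime p" "p > 2"
  shows "Legendre (-1) (int p) = quartic_sign p"
proof (rule sign_eq_of_cong)
  have "odd p" using assms prime_odd_nat by blast
  show "[Legendre (-1) (int p) = quartic_sign p] (mod int p)"
    using euler_criterion[OF assms, of "-1"] by (simp only: minus_one_power_half[OF \<open>odd p\<close>])
qed (use Legendre_values[of "-1" p] assms in \<open>auto simp: quartic_sign_def\<close>)

lemma Legendre_two:
  assumes "prime p" "p > 2"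
  shows "Legendre 2 (int p) = (if p mod 8 = 1 \<or> p mod 8 = 7 then 1 else -1)"
proof -
  have "odd p" using assms prime_odd_nat by blast
  interpret GAUSS p 2
    using assms by unfold_locales (auto simp: cong_def)
  define h where "h = (int p - 1) div 2"
  have h: "int p = 2 * h + 1" using \<open>odd p\<close> unfolding h_def by presburger
  \<comment> \<open>Doubling 1, ..., h never exceeds p - 1, so no reduction occurs and Gauss's lemma
    counts the x with h/2 < x <= h.\<close>
  have "E = (\<lambda>x. x * 2) ` {h div 2 <.. h}"
  proof -
    have "C = B" unfolding C_def B_def A_def h_def[symmetric] image_image
      using h by (intro image_cong refl) auto
    then show ?thesis unfolding E_def B_def A_def h_def[symmetric] using h assms by (auto simp: image_iff)
  qed
  then have "card E = nat (h - h div 2)"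
    by (simp add: card_image inj_on_def)
  moreover have "even (nat (h - h div 2)) \<longleftrightarrow> p mod 8 = 1 \<or> p mod 8 = 7"
  proof -
    have "h \<ge> 0" using h assms by linarith
    then have "even (nat (h - h div 2)) \<longleftrightarrow> even (h - h div 2)" by (simp add: even_nat_iff)
    also have "\<dots> \<longleftrightarrow> int p mod 8 = 1 \<or> int p mod 8 = 7" using h by presburger
    also have "\<dots> \<longleftrightarrow> p mod 8 = 1 \<or> p mod 8 = 7"
    proof -
      have "int p mod 8 = int (p mod 8)" by (simp add: zmod_int)
      then show ?thesis by auto
    qed
    finally show ?thesis .
  qed
  ultimately show ?thesis using gauss_lemma by auto
qed

text \<open>This asymmetric form makes the sign multiplicative in \<open>p\<close> for fixed
  \<open>q\<close>, so that it can be collected over the prime factors of a squarefree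
  number.\<close>

lemma Legendre_reciprocal:
  assumes "prime p" "p > 2" "prime q" "q > 2" "p \<noteq> q"
  shows "Legendre (int p) (int q) = Legendre (int q) (int p) * (if q mod 4 = 1 then 1 else quartic_sign p)"
proof -
  have odd: "odd p" "odd q" using assms prime_odd_nat by blast+
  have "Legendre p q * Legendre q p = ((-1::int) ^ ((p - 1) div 2)) ^ ((q - 1) div 2)"
    using Quadratic_Reciprocity[OF assms] by (simp add: power_mult)
  also have "\<dots> = (if q mod 4 = 1 then 1 else quartic_sign p)"
  proof -
    have "even ((q - 1) div 2) \<longleftrightarrow> q mod 4 = 1" using odd by presburger
    then show ?thesis unfolding minus_one_power_half[OF odd(1)]
      by (cases "even ((q - 1) div 2)") (auto simp: quartic_sign_def power_even_abs)
  qed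
  finally have *: "Legendre p q * Legendre q p = (if q mod 4 = 1 then 1 else quartic_sign p)" .
  moreover have "\<not> q dvd p" using assms primes_dvd_imp_eq by blast
  moreover have "\<not> p dvd q" using assms primes_dvd_imp_eq by blast
  ultimately have "Legendre q p * Legendre q p = 1"
    using Legendre_values[of q p] by (auto simp: Legendre_def cong_0_iff)
  then have "Legendre p q = (Legendre p q * Legendre q p) * Legendre q p" by simp
  then show ?thesis unfolding * by (simp only: mult.commute)
qed

lemma squarefree_eq_prod_prime_factors:
  assumes "squarefree (k::nat)"
  shows "(\<Prod>(prime_factors k)) = k"
proof -
  have k0: "k \<noteq> 0" using assms by (intro notI) simp
  have "(\<Prod>p\<in>prime_factors k. p ^ multiplicity p k) = k" using prod_prime_factors[OF k0] by simp
  moreover have "multiplicity p k = 1" if "p \<in> prime_factors k" for p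
    using squarefree_factorial_semiring'[OF k0] assms that by blast
  ultimately show ?thesis by simp
qed

text \<open>The product on the right is the Jacobi symbol (q/k): reciprocity is applied at each
  prime factor and the signs multiply to \<open>quartic_sign k\<close>.\<close>

lemma Legendre_odd_squarefree:
  assumes k: "odd k" "squarefree k" and q: "prime q" "q > 2" "\<not> q dvd k"
  shows "Legendre (int k) (int q) =
    (\<Prod>p\<in>prime_factors k. Legendre (int q) (int p)) * (if q mod 4 = 1 then 1 else quartic_sign k)"
proof -
  have p: "prime p" "p > 2" "p \<noteq> q" "odd p" if "p \<in> prime_factors k" for p
  proof -
    show "prime p" "p \<noteq> q" "odd p" using that k q by (auto simp: in_prime_factors_iff dest: dvd_trans)
    then show "p > 2" using prime_ge_2_nat[of p] by (cases "p = 2") auto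
  qed
  have "Legendre (int k) (int q) = Legendre (\<Prod>p\<in>prime_factors k. int p) (int q)"
    using squarefree_eq_prod_prime_factors[OF k(2)] by (simp flip: of_nat_prod)
  also have "\<dots> = (\<Prod>p\<in>prime_factors k. Legendre (int p) (int q))"
    using q by (simp add: Legendre_prod)
  also have "\<dots> = (\<Prod>p\<in>prime_factors k. Legendre (int q) (int p) * (if q mod 4 = 1 then 1 else quartic_sign p))"
    using p q by (intro prod.cong refl Legendre_reciprocal) auto
  also have "\<dots> = (\<Prod>p\<in>prime_factors k. Legendre (int q) (int p)) * (if q mod 4 = 1 then 1 else \<Prod>p\<in>prime_factors k. quartic_sign p)"
    by (simp add: prod.distrib)
  also have "(\<Prod>p\<in>prime_factors k. quartic_sign p) = quartic_sign k"
    using quartic_sign_prod[of "prime_factors k"] p squarefree_eq_prod_prime_factors[OF k(2)] by auto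
  finally show ?thesis .
qed

text \<open>Prime factors are adjoined one at a time, a new one by the Chinese remainder theorem and
  a repeated one by Hensel lifting. Lifting requires 2x to be invertible modulo \<open>q\<close>,
  which is why \<open>q\<close> is odd and does not divide \<open>n\<close>.\<close>

lemma dvd_square_plus_of_primes:
  fixes n :: nat
  assumes "N > 0" "\<And>q. prime q \<Longrightarrow> q dvd N \<Longrightarrow> odd q \<and> \<not> q dvd n \<and> (\<exists>x. int q dvd x\<^sup>2 + int n)"
  shows "\<exists>x. int N dvd x\<^sup>2 + int n"
  using assms
proof (induction N rule: prime_divisors_induct)
  case (unit x)
  then show ?case by simp
next
  case (factor q N)
  have N: "N > 0" using factor by simp
  obtain x where x: "int N dvd x\<^sup>2 + int n"
    using factor.IH[OF N] factor.prems by (meson dvd_mult)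
  obtain y where y: "int q dvd y\<^sup>2 + int n" and q: "odd q" "\<not> q dvd n"
    using factor.prems(2)[OF factor.hyps] by auto
  have pq: "prime (int q)" using factor.hyps by simp
  show ?case
  proof (cases "q dvd N")
    case True
    obtain j where j: "x\<^sup>2 + int n = int N * j" using x by (auto simp: dvd_def)
    have "\<not> int q dvd x"
    proof
      assume "int q dvd x"
      moreover have "int q dvd x\<^sup>2 + int n" using True x by (meson dvd_trans int_dvd_int_iff)
      ultimately have "int q dvd int n" by (metis dvd_add_right_iff dvd_mult power2_eq_square)
      then show False using q by simp
    qed
    moreover have "\<not> int q dvd 2" using q pq by (metis even_of_nat prime_nat_iff primes_dvd_imp_eq two_is_prime_nat dvd_refl int_dvd_int_iff of_nat_numeral factor.hyps)
    ultimately have "\<not> int q dvd 2 * x" using pq by (simp add: prime_dvd_mult_iff)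
    then have "coprime (2 * x) (int q)" using prime_imp_coprime[OF pq] coprime_commute by blast
    \<comment> \<open>Newton step: \<open>t\<close> cancels the quotient \<open>j\<close> modulo
      \<open>q\<close>, and the quadratic term is divisible by \<open>q\<close> since
      \<open>N\<close> is.\<close>
    then obtain t where t: "[2 * x * t = - j] (mod int q)" using cong_solve_coprime_int[of "2 * x" "int q"]
      by (metis cong_scalar_right mult.assoc mult_1)
    have "int q dvd 2 * x * t + j" using t by (simp add: cong_iff_dvd_diff)
    moreover have "int q dvd int N * t\<^sup>2" using True by simp
    ultimately have "int q dvd (2 * x * t + j) + int N * t\<^sup>2" by (rule dvd_add)
    moreover have "(x + int N * t)\<^sup>2 + int n = int N * ((2 * x * t + j) + int N * t\<^sup>2)"
    proof -
      have "(x + int N * t)\<^sup>2 + int n = (x\<^sup>2 + int n) + int N * (2 * x * t + int N * t\<^sup>2)"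
        by (simp add: power2_eq_square algebra_simps)
      then show ?thesis unfolding j by (simp add: algebra_simps)
    qed
    ultimately have "int (q * N) dvd (x + int N * t)\<^sup>2 + int n" by (simp add: mult.commute)
    then show ?thesis by blast
  next
    case False
    then have cop: "coprime (int N) (int q)"
      using prime_imp_coprime[OF factor.hyps] by (simp add: coprime_commute)
    obtain z where z: "[z = x] (mod int N)" "[z = y] (mod int q)"
      using binary_chinese_remainder_int[OF cop] by blast
    have "[z\<^sup>2 + int n = x\<^sup>2 + int n] (mod int N)" "[z\<^sup>2 + int n = y\<^sup>2 + int n] (mod int q)"
      using z by (auto intro: cong_add cong_pow)
    then have "int N dvd z\<^sup>2 + int n" "int q dvd z\<^sup>2 + int n"
      using x y by (simp_all add: cong_dvd_iff)
    then have "int N * int q dvd z\<^sup>2 + int n" using cop by (simp add: divides_mult)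
    then show ?thesis by (auto simp: mult.commute)
  qed
qed auto

section \<open>Unimodular ternary forms\<close>

text \<open>The matrix of the form is \<open>((a, f, e), (f, b, d), (e, d, c))\<close>.\<close>
definition ternary :: "int \<Rightarrow> int \<Rightarrow> int \<Rightarrow> int \<Rightarrow> int \<Rightarrow> int \<Rightarrow> int \<Rightarrow> int \<Rightarrow> int \<Rightarrow> int" where
  "ternary a b c d e f x y z = a * x\<^sup>2 + b * y\<^sup>2 + c * z\<^sup>2 + 2 * d * y * z + 2 * e * x * z + 2 * f * x * y"

text \<open>\<open>A\<close> and \<open>B\<close> are the first two leading principal minors of a unimodular ternary form representing \<open>n\<close>;
  the determinant condition is multiplied by \<open>A\<close>, as \<open>B (A c - e\<^sup>2) - (A d - e f)\<^sup>2 = A \<cdot> det\<close>.\<close>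
definition unimodular_rep :: "int \<Rightarrow> nat \<Rightarrow> nat \<Rightarrow> bool" where
  "unimodular_rep n A B \<longleftrightarrow> A > 0 \<and> B > 0 \<and> (\<exists>b c d e f x y z. int B = int A * b - f\<^sup>2
     \<and> int B * (int A * c - e\<^sup>2) - (int A * d - e * f)\<^sup>2 = int A
     \<and> ternary (int A) b c d e f x y z = n)"

lemma unimodular_repI:
  assumes "a > 0" "D > 0" "D = a * b - f\<^sup>2"
    "D * (a * c - e\<^sup>2) - (a * d - e * f)\<^sup>2 = a"
    "ternary a b c d e f x y z = n"
  shows "unimodular_rep n (nat a) (nat D)"
proof -
  have int_nat: "int (nat a) = a" "int (nat D) = D" using assms by auto
  have "\<exists>b c d e f x y z. D = a * b - f\<^sup>2 \<and> D * (a * c - e\<^sup>2) - (a * d - e * f)\<^sup>2 = a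
      \<and> ternary a b c d e f x y z = n"
    using assms(3-5) by blast
  then show ?thesis unfolding unimodular_rep_def int_nat zero_less_nat_eq using assms(1,2) by blast
qed

lemma ternary_shift_x:
  "ternary a (b + 2 * k * f + k\<^sup>2 * a) c (d + k * e) e (f + k * a) (x - k * y) y z = ternary a b c d e f x y z"
  unfolding ternary_def by Groebner_Basis.algebra

lemma ternary_shift_y:
  "ternary a b (c + 2 * l * d + l\<^sup>2 * b) (d + l * b) (e + l * f) f x (y - l * z) z = ternary a b c d e f x y z"
  unfolding ternary_def by Groebner_Basis.algebra

lemma exists_nearest_multiple:
  fixes a m :: int
  assumes "m > 0"
  shows "\<exists>k. \<bar>2 * (a + k * m)\<bar> \<le> m"
proof -
  define r where "r = a mod m"
  have r: "0 \<le> r" "r < m" "a + (- (a div m)) * m = r" using assms by (auto simp: r_def minus_div_mult_eq_mod)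
  show ?thesis
  proof (cases "2 * r \<le> m")
    case True
    then show ?thesis using r by (intro exI[of _ "- (a div m)"]) auto
  next
    case False
    have "a + (- (a div m) - 1) * m = r - m" using r by (simp add: algebra_simps)
    then show ?thesis using r False by (intro exI[of _ "- (a div m) - 1"]) auto
  qed
qed

text \<open>Hermite reduction: with \<open>A\<close> and then \<open>B\<close> minimal, the reduction inequalities \<open>3 A\<^sup>2 \<le> 4 B\<close> and
  \<open>3 B\<^sup>2 \<le> 4 A\<close> force \<open>A = B = 1\<close>.\<close>
lemma unimodular_rep_sum_of_three_squares:
  assumes "unimodular_rep n A0 B0"
  shows "\<exists>u v w. n = u\<^sup>2 + v\<^sup>2 + w\<^sup>2"
proof -
  \<comment> \<open>The pair is minimised lexicographically: first \<open>A\<close>, then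
    \<open>B\<close> for this \<open>A\<close>.\<close>
  define A where "A = (LEAST A. \<exists>B. unimodular_rep n A B)"
  define B where "B = (LEAST B. unimodular_rep n A B)"
  have "\<exists>B. unimodular_rep n A B" unfolding A_def using assms by (rule_tac LeastI) blast
  then have AB: "unimodular_rep n A B" unfolding B_def by (auto intro: LeastI)
  have minA: "A \<le> A'" if "unimodular_rep n A' B'" for A' B'
    unfolding A_def using that by (intro Least_le) blast
  have minB: "B \<le> B'" if "unimodular_rep n A B'" for B'
    unfolding B_def using that by (intro Least_le) blast
  obtain b0 c0 d0 e0 f0 x0 y0 z0 where 0: "int B = int A * b0 - f0\<^sup>2"
     "int B * (int A * c0 - e0\<^sup>2) - (int A * d0 - e0 * f0)\<^sup>2 = int A"
     "ternary (int A) b0 c0 d0 e0 f0 x0 y0 z0 = n" and pos: "A > 0" "B > 0"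
    using AB by (auto simp: unimodular_rep_def)
  obtain k where k: "\<bar>2 * (f0 + k * int A)\<bar> \<le> int A" using exists_nearest_multiple pos by fastforce
  define f where "f = f0 + k * int A"
  define b where "b = b0 + 2 * k * f0 + k\<^sup>2 * int A"
  define d1 where "d1 = d0 + k * e0"
  have B_eq: "int B = int A * b - f\<^sup>2"
    using 0(1) by (simp add: f_def b_def power2_eq_square algebra_simps)
  have D_eq: "int A * d1 - e0 * f = int A * d0 - e0 * f0"
    by (simp add: f_def d1_def algebra_simps)
  have val1: "ternary (int A) b c0 d1 e0 f (x0 - k * y0) y0 z0 = n"
    unfolding 0(3)[symmetric] b_def d1_def f_def by (rule ternary_shift_x)
  obtain l where l: "\<bar>2 * ((int A * d1 - e0 * f) + l * int B)\<bar> \<le> int B"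
    using exists_nearest_multiple[of "int B" "int A * d1 - e0 * f"] pos by auto
  define d where "d = d1 + l * b"
  define e where "e = e0 + l * f"
  define c where "c = c0 + 2 * l * d1 + l\<^sup>2 * b"
  define x y z where "x = x0 - k * y0" and "y = y0 - l * z0" and "z = z0"
  define C where "C = int A * c - e\<^sup>2"
  have D_eq': "int A * d - e * f = (int A * d1 - e0 * f) + l * int B"
    unfolding d_def e_def B_eq by (simp add: power2_eq_square algebra_simps)
  have C_eq: "C = (int A * c0 - e0\<^sup>2) + 2 * l * (int A * d1 - e0 * f) + l\<^sup>2 * int B"
    unfolding C_def c_def e_def B_eq by (simp add: power2_eq_square algebra_simps)
  have val: "ternary (int A) b c d e f x y z = n"
    unfolding val1[symmetric] c_def d_def e_def x_def y_def z_def by (rule ternary_shift_y)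
  have det: "int B * C - (int A * d - e * f)\<^sup>2 = int A"
    by (rule trans[OF _ 0(2)]) (unfold D_eq' C_eq D_eq, simp add: power2_eq_square algebra_simps)
  have l': "\<bar>2 * (int A * d - e * f)\<bar> \<le> int B" using l D_eq' by simp
  have "b * int A > 0" using B_eq pos zero_le_power2[of f] by (simp only: mult.commute)
  then have b: "b > 0" using pos by (simp add: zero_less_mult_iff)
  \<comment> \<open>Interchanging the first two variables keeps the minor \<open>B\<close> and makes
    \<open>b\<close> the leading entry, whence A <= b.\<close>
  have "unimodular_rep n (nat b) B"
  proof -
    have "int A * (int B * (b * c - d\<^sup>2) - (b * e - d * f)\<^sup>2) = b * (int B * C - (int A * d - e * f)\<^sup>2)"
      unfolding C_def B_eq by Groebner_Basis.algebra
    then have s1: "int B * (b * c - d\<^sup>2) - (b * e - d * f)\<^sup>2 = b"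
      unfolding det using pos by (simp add: mult.commute)
    have s2: "int B = b * int A - f\<^sup>2" using B_eq by (simp add: mult.commute)
    have s3: "ternary b (int A) c e d f y x z = n"
      unfolding val[symmetric] ternary_def by (simp add: algebra_simps)
    show ?thesis using unimodular_repI[OF b _ s2 s1 s3] pos by simp
  qed
  then have Ab: "int A \<le> b" using minA b by fastforce
  have "int B * C > 0" using det pos zero_le_power2[of "int A * d - e * f"] by linarith
  then have C: "C > 0" using pos by (simp add: zero_less_mult_iff)
  \<comment> \<open>Interchanging the last two variables keeps \<open>A\<close> and replaces the
    minor \<open>B\<close> by \<open>C\<close>, whence B <= C.\<close>
  have "unimodular_rep n A (nat C)"
  proof -
    have s1: "C * (int A * b - f\<^sup>2) - (int A * d - f * e)\<^sup>2 = int A"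
      using det B_eq by (simp add: mult.commute)
    have s2: "ternary (int A) c b d f e x z y = n"
      unfolding val[symmetric] ternary_def by (simp add: algebra_simps)
    show ?thesis using unimodular_repI[OF _ C C_def s1 s2] pos by simp
  qed
  then have BC: "int B \<le> C" using minB C by fastforce
  \<comment> \<open>Since 4 f^2 <= A^2 <= A b, the identity B = A b - f^2 gives the first
    inequality. The second is the same argument for A = B C - (A d - e f)^2.\<close>
  have "(2 * f)\<^sup>2 \<le> (int A)\<^sup>2" using k by (simp add: f_def abs_le_square_iff[symmetric])
  moreover have "(int A)\<^sup>2 \<le> int A * b" using Ab by (simp add: power2_eq_square mult_left_mono)
  ultimately have ineq1: "3 * (int A)\<^sup>2 \<le> 4 * int B" using B_eq by (simp add: power_mult_distrib)
  have "(2 * (int A * d - e * f))\<^sup>2 \<le> (int B)\<^sup>2" using l' by (simp add: abs_le_square_iff[symmetric])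
  moreover have "(int B)\<^sup>2 \<le> int B * C" using BC by (simp add: power2_eq_square mult_left_mono)
  ultimately have ineq2: "3 * (int B)\<^sup>2 \<le> 4 * int A" using det unfolding power_mult_distrib by simp
  have "int A \<le> 1"
  proof (rule ccontr)
    assume "\<not> int A \<le> 1"
    then have A2: "int A \<ge> 2" by simp
    have "2 * int A \<le> int A * int A" using A2 by (intro mult_right_mono) auto
    moreover have "2 * int B \<le> int B * int B" if "int B \<ge> int A" using A2 that by (intro mult_right_mono) auto
    ultimately show False using ineq1 ineq2 A2 unfolding power2_eq_square by (cases "int B \<ge> int A") linarith+
  qed
  then have A: "A = 1" using pos by simp
  have B: "B = 1"
  proof (rule ccontr)
    assume "B \<noteq> 1"
    then have "2 * int B \<le> int B * int B" using pos by (intro mult_right_mono) auto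
    moreover have "int B \<ge> 2" using \<open>B \<noteq> 1\<close> pos by linarith
    ultimately show False using ineq2 A unfolding power2_eq_square by linarith
  qed
  have "f = 0" using k A by (simp add: f_def)
  moreover have "d = 0" using l' A B \<open>f = 0\<close> by simp
  moreover have "b = 1" using B_eq A B \<open>f = 0\<close> by simp
  moreover have "c = 1 + e\<^sup>2" using det A B \<open>f = 0\<close> \<open>d = 0\<close> by (simp add: C_def)
  \<comment> \<open>The entry \<open>e\<close> is never reduced; as c = 1 + e^2, completing the
    square absorbs it.\<close>
  ultimately have "n = (x + e * z)\<^sup>2 + y\<^sup>2 + z\<^sup>2"
    using val A by (simp add: ternary_def power2_eq_square algebra_simps)
  then show ?thesis by blast
qed

text \<open>The form with matrix \<open>((a, xD, s), (xD, N, 0), (s, 0, n))\<close> is unimodular, where \<open>a = ((xD)\<^sup>2 + D) / N\<close>.\<close>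
lemma sum_of_three_squares_if_dvd:
  assumes N: "N > 0" and "int n * D = int s ^ 2 * int N + 1" and "int N dvd x\<^sup>2 + int n"
  shows "\<exists>u v w. int n = u\<^sup>2 + v\<^sup>2 + w\<^sup>2"
proof -
  have "int n * D > 0" using assms by simp
  then have D: "D > 0" by (simp add: zero_less_mult_iff)
  have "(x * D)\<^sup>2 + D = (x\<^sup>2 + int n) * D\<^sup>2 - int N * int s ^ 2 * D"
    using assms(2) by Groebner_Basis.algebra
  then have "int N dvd (x * D)\<^sup>2 + D" using assms(3) by simp
  then obtain a where a: "(x * D)\<^sup>2 + D = int N * a" by (auto simp: dvd_def)
  then have "int N * a > 0" using D zero_le_power2[of "x * D"] by linarith
  then have a0: "a > 0" using N by (simp add: zero_less_mult_iff)
  have "D = a * int N - (x * D)\<^sup>2" using a by Groebner_Basis.algebra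
  moreover have "D * (a * int n - int s ^ 2) - (a * 0 - int s * (x * D))\<^sup>2 = a"
    using a assms(2) by Groebner_Basis.algebra
  moreover have "ternary a (int N) (int n) 0 (int s) (x * D) 0 0 1 = int n" by (simp add: ternary_def)
  ultimately have "unimodular_rep (int n) (nat a) (nat D)"
    by (intro unimodular_repI[OF a0 D])
  then show ?thesis by (rule unimodular_rep_sum_of_three_squares)
qed

section \<open>Sums of three squares\<close>

text \<open>These characters carry the sign and the factor 2 of the Kronecker character; the
  Legendre symbols carry its odd primes.\<close>

definition mod8_character :: "(nat \<Rightarrow> int) \<Rightarrow> bool" where
  "mod8_character e \<longleftrightarrow> (\<forall>a. e (a mod 8) = e a) \<and> (\<forall>a b. e (a * b) = e a * e b)
     \<and> (\<forall>a. odd a \<longrightarrow> e a = 1 \<or> e a = -1) \<and> (\<forall>a. even a \<longrightarrow> e a = 0)"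

text \<open>The units modulo 8 are generated by 3 and 5, both of order 2, so the signs there are
  free and 7, congruent to 3 times 5, receives \<open>u * v\<close>.\<close>

lemma mod8_character_signs:
  fixes e :: "nat \<Rightarrow> int"
  assumes e: "\<And>m. e m = (if even m then 0 else if m mod 8 = 1 then 1 else if m mod 8 = 3 then u
      else if m mod 8 = 5 then v else u * v)" and uv: "u = 1 \<or> u = -1" "v = 1 \<or> v = -1"
  shows "mod8_character e"
proof -
  have "e (a * b) = e a * e b" for a b
  proof (cases "even a \<or> even b")
    case False
    then have "a mod 8 \<in> {1, 3, 5, 7}" "b mod 8 \<in> {1, 3, 5, 7}"
      unfolding insert_iff empty_iff by presburger+
    moreover define g :: "nat \<Rightarrow> int" where "g = (\<lambda>r. if r = 1 then 1 else if r = 3 then u else if r = 5 then v else u * v)"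
    have "g (x * y mod 8) = g x * g y" if "x \<in> {1, 3, 5, 7}" "y \<in> {1, 3, 5, 7}" for x y
    proof -
      have "u * u = 1" "v * v = 1" using uv by auto
      then show ?thesis using that unfolding insert_iff empty_iff
        by (elim disjE FalseE) (simp_all add: g_def mult.commute mult.left_commute)
    qed
    ultimately have "g ((a mod 8) * (b mod 8) mod 8) = g (a mod 8) * g (b mod 8)" by blast
    then have "g (a * b mod 8) = g (a mod 8) * g (b mod 8)" by (simp only: mod_mult_eq)
    moreover have "e m = g (m mod 8)" if "odd m" for m using that by (simp add: e g_def)
    ultimately show ?thesis using False by simp
  next
    case True
    then have "e (a * b) = 0" "e a = 0 \<or> e b = 0" unfolding e by auto
    then show ?thesis by auto
  qed
  moreover have "e (a mod 8) = e a" for a unfolding e mod_mod_trivial by (simp add: dvd_mod_iff)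
  moreover have "odd a \<Longrightarrow> e a = 1 \<or> e a = -1" "even a \<Longrightarrow> e a = 0" for a
    unfolding e using uv by auto
  ultimately show ?thesis unfolding mod8_character_def by blast
qed

lemma coprime_8_iff_odd: "coprime (a::nat) 8 \<longleftrightarrow> odd a"
proof -
  have "coprime a (2 ^ 3) \<longleftrightarrow> odd a" unfolding coprime_power_right_iff by (simp add: coprime_right_2_iff_odd)
  then show ?thesis by simp
qed

lemma real_character_Legendre:
  fixes e :: "nat \<Rightarrow> int"
  assumes e: "mod8_character e" and k: "odd k" "squarefree k"
  shows "real_character (8 * k) (\<lambda>m. of_int (e m * (\<Prod>p\<in>prime_factors k. Legendre (int m) (int p))))"
proof -
  have k0: "k > 0" using k by (auto intro: Nat.gr0I)
  have p: "prime p" "p > 2" "p dvd k" if "p \<in> prime_factors k" for p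
  proof -
    show "prime p" "p dvd k" using that by (auto simp: in_prime_factors_iff)
    then have "odd p" using k(1) by (auto dest: dvd_trans)
    then show "p > 2" using prime_ge_2_nat[OF \<open>prime p\<close>] by (cases "p = 2") auto
  qed
  have L0: "Legendre (int m) (int p) = 0 \<longleftrightarrow> p dvd m" for m p
    by (simp add: Legendre_def cong_0_iff)
  show ?thesis
  proof
    show "8 * k > 0" using k0 by simp
    fix a b
    show "of_int (e (a * b) * (\<Prod>p\<in>prime_factors k. Legendre (int (a * b)) (int p))) =
      (of_int (e a * (\<Prod>p\<in>prime_factors k. Legendre (int a) (int p))) *
       of_int (e b * (\<Prod>p\<in>prime_factors k. Legendre (int b) (int p))) :: real)"
      using e p by (simp add: mod8_character_def Legendre_mult prod.distrib)
    have "e (a mod (8 * k)) = e a"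
      using e unfolding mod8_character_def by (metis mod_mult_right_eq mod_mod_cancel dvd_triv_left)
    moreover have "Legendre (int (a mod (8 * k))) (int p) = Legendre (int a) (int p)" if "p \<in> prime_factors k" for p
    proof (rule Legendre_cong)
      have "p dvd 8 * k" using p[OF that] by simp
      then have "a mod (8 * k) mod p = a mod p" by (rule mod_mod_cancel)
      then show "[int (a mod (8 * k)) = int a] (mod int p)" by (simp only: cong_def flip: zmod_int)
    qed
    ultimately show "(of_int (e (a mod (8 * k)) * (\<Prod>p\<in>prime_factors k. Legendre (int (a mod (8 * k))) (int p))) :: real) =
       of_int (e a * (\<Prod>p\<in>prime_factors k. Legendre (int a) (int p)))"
      by simp
    have sign: "(\<Prod>p\<in>S. Legendre (int a) (int p)) \<in> {1, -1}" if "finite S" "\<And>p. p \<in> S \<Longrightarrow> \<not> p dvd a" for S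
      using that
    proof (induction S rule: finite_induct)
      case (insert p S)
      then show ?case using Legendre_values[of "int a" "int p"] L0[of a p] by auto
    qed simp
    {
      assume cop: "coprime a (8 * k)"
      then have "\<not> p dvd a" if "p \<in> prime_factors k" for p
        using p[OF that] by (metis coprime_common_divisor_nat dvd_mult not_prime_1)
      moreover have "odd a" using cop by (simp add: coprime_8_iff_odd)
      ultimately have "e a * (\<Prod>p\<in>prime_factors k. Legendre (int a) (int p)) = 1 \<or>
          e a * (\<Prod>p\<in>prime_factors k. Legendre (int a) (int p)) = -1"
        using sign[of "prime_factors k"] e[unfolded mod8_character_def, THEN conjunct2, THEN conjunct2, THEN conjunct1, rule_format, of a]
        by auto
      then show "of_int (e a * (\<Prod>p\<in>prime_factors k. Legendre (int a) (int p))) = (1 :: real) \<or>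
          of_int (e a * (\<Prod>p\<in>prime_factors k. Legendre (int a) (int p))) = (-1 :: real)"
        by (elim disjE) (simp_all only: of_int_1 of_int_minus, simp_all)
    next
      assume "\<not> coprime a (8 * k)"
      then consider "even a" | "\<not> coprime a k" by (auto simp: coprime_8_iff_odd)
      then show "of_int (e a * (\<Prod>p\<in>prime_factors k. Legendre (int a) (int p))) = (0 :: real)"
      proof cases
        case 1
        then show ?thesis using e by (simp add: mod8_character_def)
      next
        case 2
        then obtain p where "prime p" "p dvd a" "p dvd k"
          by (metis coprime_iff_gcd_eq_1 gcd_greatest_iff prime_factor_nat)
        then have "p \<in> prime_factors k" "Legendre (int a) (int p) = 0" using k0 L0 by (auto simp: in_prime_factors_iff)
        then have "(\<Prod>p\<in>prime_factors k. Legendre (int a) (int p)) = 0" by (intro prod_zero) auto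
        then show ?thesis by simp
      qed
    }
  qed
qed

text \<open>By reciprocity, assumption \<open>h\<close> says that \<open>e\<close> times the Legendre symbols modulo the primes of \<open>k\<close> is the
  Kronecker character of \<open>-n\<close>.\<close>
lemma three_squares_of_character:
  fixes c k n \<alpha> :: nat
  assumes e: "mod8_character e" and k: "odd k" "squarefree k" and c: "c = 1 \<or> c = 2" and n: "n = c * k"
    and h: "\<And>q. prime q \<Longrightarrow> q > 2 \<Longrightarrow> Legendre (- int c) (int q) = e q * (if q mod 4 = 1 then 1 else quartic_sign k)"
    and \<alpha>: "odd \<alpha>" "e \<alpha> * quartic_sign k = 1"
  shows "\<exists>u v w. int n = u\<^sup>2 + v\<^sup>2 + w\<^sup>2"
proof -
  have k0: "k > 0" using k by (auto intro: Nat.gr0I)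
  define \<chi> :: "nat \<Rightarrow> real" where "\<chi> = (\<lambda>m. of_int (e m * (\<Prod>p\<in>prime_factors k. Legendre (int m) (int p))))"
  have char: "real_character (8 * k) \<chi>" unfolding \<chi>_def by (rule real_character_Legendre[OF e k])
  interpret x: real_character "8 * k" \<chi> by (rule char)
  have "coprime 8 k" using k(1) coprime_8_iff_odd coprime_commute by blast
  \<comment> \<open>The intended class of \<open>N * s^2\<close>: -1 modulo \<open>k\<close>,
    written as \<open>k - 1\<close> in the naturals, and \<open>\<alpha>\<close> modulo 8.\<close>
  then obtain a where a: "[a = \<alpha>] (mod 8)" "[a = k - 1] (mod k)"
    using binary_chinese_remainder_nat by blast
  have ea: "e a = e \<alpha>" using e a(1) unfolding mod8_character_def cong_def by metis
  have ak: "[int a = -1] (mod int k)"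
  proof -
    have "[int a = int (k - 1)] (mod int k)" using a(2) by (simp only: cong_int_iff)
    also have "[int (k - 1) = -1] (mod int k)" using k0 by (simp add: of_nat_diff cong_iff_dvd_diff)
    finally show ?thesis .
  qed
  have p: "prime p" "p > 2" "p dvd k" if "p \<in> prime_factors k" for p
  proof -
    show "prime p" "p dvd k" using that by (auto simp: in_prime_factors_iff)
    then have "odd p" using k(1) by (auto dest: dvd_trans)
    then show "p > 2" using prime_ge_2_nat[OF \<open>prime p\<close>] by (cases "p = 2") auto
  qed
  have "(\<Prod>p\<in>prime_factors k. Legendre (int a) (int p)) = (\<Prod>p\<in>prime_factors k. quartic_sign p)"
  proof (rule prod.cong)
    fix p assume "p \<in> prime_factors k"
    then have "[int a = -1] (mod int p)" using ak p(3)[of p] by (auto intro: cong_dvd_modulus)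
    then show "Legendre (int a) (int p) = quartic_sign p"
      using Legendre_cong Legendre_minus_one p[of p] \<open>p \<in> prime_factors k\<close> by metis
  qed simp
  also have "\<dots> = quartic_sign k"
    using quartic_sign_prod[of "prime_factors k"] p squarefree_eq_prod_prime_factors[OF k(2)] prime_odd_nat by auto
  finally have "\<chi> a = 1" unfolding \<chi>_def ea using \<alpha>(2) by simp
  then obtain N s where N: "N > 0" "\<And>q. prime q \<Longrightarrow> q dvd N \<Longrightarrow> \<chi> q = 1" "[N * s\<^sup>2 = a] (mod (8 * k))"
    using exists_split_times_square[OF char] by blast
  have "odd q \<and> \<not> q dvd n \<and> (\<exists>x. int q dvd x\<^sup>2 + int n)" if q: "prime q" "q dvd N" for q
  proof -
    have \<chi>q: "\<chi> q = 1" using N(2) q by blast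
    have oq: "odd q" using \<chi>q e unfolding \<chi>_def mod8_character_def by force
    then have q2: "q > 2" using prime_ge_2_nat[OF q(1)] by (cases "q = 2") auto
    have qk: "\<not> q dvd k"
    proof
      assume "q dvd k"
      then have "\<not> coprime q (8 * k)" using q by (metis coprime_common_divisor_nat dvd_mult dvd_refl not_prime_1)
      then show False using x.zero \<chi>q by simp
    qed
    \<comment> \<open>Assumption \<open>h\<close> and reciprocity each contribute the same sign; the
      two cancel and leave \<open>\<chi> q\<close>, which is 1.\<close>
    have "Legendre (- int n) (int q) = Legendre (- int c) (int q) * Legendre (int k) (int q)"
      using Legendre_mult[OF q(1) q2, of "- int c" "int k"] by (simp add: n)
    also have "\<dots> = e q * (\<Prod>p\<in>prime_factors k. Legendre (int q) (int p)) * (if q mod 4 = 1 then 1 else (quartic_sign k)\<^sup>2)"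
      unfolding h[OF q(1) q2] Legendre_odd_squarefree[OF k q(1) q2 qk] by (simp add: power2_eq_square)
    also have "\<dots> = 1"
    proof -
      have "e q * (\<Prod>p\<in>prime_factors k. Legendre (int q) (int p)) = 1"
        using \<chi>q unfolding \<chi>_def by linarith
      then show ?thesis by (simp add: quartic_sign_def)
    qed
    finally have "QuadRes (int q) (- int n)" by (auto simp: Legendre_def split: if_splits)
    then obtain y where "[y\<^sup>2 = - int n] (mod int q)" by (auto simp: QuadRes_def)
    then have "int q dvd y\<^sup>2 + int n" by (simp add: cong_iff_dvd_diff)
    moreover have "\<not> q dvd n"
    proof
      assume "q dvd n"
      then have "q dvd c" using q(1) qk by (simp add: n prime_dvd_mult_iff)
      then show False using c q2 by (auto dest: dvd_imp_le)
    qed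
    ultimately show ?thesis using oq by blast
  qed
  then obtain x where x: "int N dvd x\<^sup>2 + int n" using dvd_square_plus_of_primes[OF N(1)] by blast
  have "k dvd s\<^sup>2 * N + 1"
  proof -
    have "[N * s\<^sup>2 + 1 = a + 1] (mod k)" using N(3) by (intro cong_add) (auto intro: cong_dvd_modulus_nat)
    also have "[a + 1 = k - 1 + 1] (mod k)" using a(2) by (intro cong_add) auto
    finally have "[N * s\<^sup>2 + 1 = k] (mod k)" using k0 by simp
    then have "(N * s\<^sup>2 + 1) mod k = 0" by (simp add: cong_def)
    then show ?thesis by (simp add: mult.commute dvd_eq_mod_eq_0)
  qed
  \<comment> \<open>For \<open>c = 2\<close> the number \<open>s^2 * N + 1\<close> must be even
    besides being divisible by \<open>k\<close>.\<close>
  moreover have "odd (s\<^sup>2 * N)"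
  proof -
    have "[N * s\<^sup>2 = a] (mod 2)" "[a = \<alpha>] (mod 2)"
      using N(3) a(1) by (auto intro: cong_dvd_modulus_nat)
    then have "[N * s\<^sup>2 = \<alpha>] (mod 2)" by (rule cong_trans)
    then have "even (N * s\<^sup>2) \<longleftrightarrow> even \<alpha>" by (rule cong_dvd_iff)
    then show ?thesis using \<alpha>(1) by (simp add: mult.commute)
  qed
  ultimately have "n dvd s\<^sup>2 * N + 1"
    using c k(1) unfolding n by (auto intro!: divides_mult simp: coprime_left_2_iff_odd)
  then obtain D where "s\<^sup>2 * N + 1 = n * D" by (auto simp: dvd_def)
  then have "int n * int D = int s ^ 2 * int N + 1" by (metis of_nat_1 of_nat_add of_nat_mult of_nat_power)
  then show ?thesis using sum_of_three_squares_if_dvd N(1) x by blast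
qed

lemma three_squares_squarefree:
  assumes n: "squarefree n" "n mod 4 = 1 \<or> n mod 4 = 2"
  shows "\<exists>u v w. int n = u\<^sup>2 + v\<^sup>2 + w\<^sup>2"
proof -
  \<comment> \<open>With values \<open>u\<close> at 3 and \<open>v\<close> at 5, the signs (-1, 1),
    (1, -1) and (-1, -1) give the characters (-1/m), (-2/m) and (2/m) on odd m.\<close>
  define e where "e = (\<lambda>u v (m::nat). if even m then 0 else if m mod 8 = 1 then 1 else if m mod 8 = 3 then u
      else if m mod 8 = 5 then v else u * v :: int)"
  have e': "mod8_character (e u v)" if "u = 1 \<or> u = -1" "v = 1 \<or> v = -1" for u v
    using that by (intro mod8_character_signs[where u = u and v = v]) (auto simp: e_def)
  have e: "mod8_character (e (-1) 1)" "mod8_character (e 1 (-1))" "mod8_character (e (-1) (-1))"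
    by (simp_all add: e')
  have mod8: "q mod 8 = 1 \<and> q mod 4 = 1 \<or> q mod 8 = 3 \<and> q mod 4 = 3 \<or> q mod 8 = 5 \<and> q mod 4 = 1 \<or> q mod 8 = 7 \<and> q mod 4 = 3"
    if "odd q" for q :: nat using that by presburger
  have L2: "Legendre (-2) (int q) = quartic_sign q * (if q mod 8 = 1 \<or> q mod 8 = 7 then 1 else -1)"
    if "prime q" "q > 2" for q
    using Legendre_mult[OF that, of "-1" 2] that by (simp add: Legendre_minus_one Legendre_two)
  consider "n mod 4 = 1" | k where "n = 2 * k" "k mod 4 = 1" | k where "n = 2 * k" "k mod 4 = 3"
  proof -
    have "\<exists>k. n = 2 * k \<and> (k mod 4 = 1 \<or> k mod 4 = 3)" if "n mod 4 = 2" using that by presburger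
    then show thesis using n(2) that by blast
  qed
  then show ?thesis
  proof cases
    case 1
    have k: "odd n" "squarefree n" using 1 n(1) by presburger+
    have h: "Legendre (- int 1) (int q) = e (-1) 1 q * (if q mod 4 = 1 then 1 else quartic_sign n)"
      if q: "prime q" "q > 2" for q
    proof -
      have "odd q" using q prime_odd_nat by blast
      then show ?thesis using Legendre_minus_one[OF q] mod8[of q] 1 by (auto simp: e_def quartic_sign_def)
    qed
    have \<alpha>: "odd (1::nat)" "e (-1) 1 1 * quartic_sign n = 1"
      using 1 by (simp_all add: e_def quartic_sign_def)
    show ?thesis by (rule three_squares_of_character[OF e(1) k _ _ h \<alpha>]) (use 1 in simp_all)
  next
    case (2 k)
    have k: "odd k" "squarefree k" using 2(2) n(1) 2(1) squarefree_mono[of k n] by (presburger, simp)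
    have h: "Legendre (- int 2) (int q) = e 1 (-1) q * (if q mod 4 = 1 then 1 else quartic_sign k)"
      if q: "prime q" "q > 2" for q
    proof -
      have "odd q" using q prime_odd_nat by blast
      then show ?thesis using L2[OF q] mod8[of q] 2(2) by (auto simp: e_def quartic_sign_def)
    qed
    have \<alpha>: "odd (1::nat)" "e 1 (-1) 1 * quartic_sign k = 1"
      using 2(2) by (simp_all add: e_def quartic_sign_def)
    show ?thesis by (rule three_squares_of_character[OF e(2) k _ _ h \<alpha>]) (use 2(1) in simp_all)
  next
    case (3 k)
    have k: "odd k" "squarefree k" using 3(2) n(1) 3(1) squarefree_mono[of k n] by (presburger, simp)
    have h: "Legendre (- int 2) (int q) = e (-1) (-1) q * (if q mod 4 = 1 then 1 else quartic_sign k)"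
      if q: "prime q" "q > 2" for q
    proof -
      have "odd q" using q prime_odd_nat by blast
      then show ?thesis using L2[OF q] mod8[of q] 3(2) by (auto simp: e_def quartic_sign_def)
    qed
    \<comment> \<open>Here \<open>quartic_sign k\<close> is -1; the class of 5 compensates, since
      the character (2/m) is -1 there.\<close>
    have \<alpha>: "odd (5::nat)" "e (-1) (-1) 5 * quartic_sign k = 1"
      using 3(2) by (simp_all add: e_def quartic_sign_def)
    show ?thesis by (rule three_squares_of_character[OF e(3) k _ _ h \<alpha>]) (use 3(1) in simp_all)
  qed
qed

text \<open>As 4 does not divide \<open>n\<close>, the square divided out is odd and hence 1 modulo
  4, so the squarefree part keeps the residue class.\<close>

lemma three_squares:
  fixes n :: nat
  assumes "n mod 4 = 1 \<or> n mod 4 = 2"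
  shows "\<exists>u v w. int n = u\<^sup>2 + v\<^sup>2 + w\<^sup>2"
proof -
  define k m where "k = squarefree_part n" and "m = square_part n"
  have n: "n = k * m\<^sup>2" unfolding k_def m_def by (rule squarefree_decompose)
  have "odd m"
  proof
    assume "even m"
    then have "4 dvd n" by (auto simp: n power2_eq_square elim!: evenE)
    then show False using assms by (auto simp: dvd_eq_mod_eq_0)
  qed
  then have "m\<^sup>2 mod 4 = 1" unfolding power2_eq_square
    using odd_mod_4[of m] mod_mult_eq[of m 4 m] by auto
  then have "n mod 4 = k mod 4" unfolding n using mod_mult_right_eq[of k "m\<^sup>2" 4] by simp
  moreover have "squarefree k" by (simp add: k_def)
  ultimately obtain u v w where "int k = u\<^sup>2 + v\<^sup>2 + w\<^sup>2" using three_squares_squarefree assms by metis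
  then have "int n = (u * int m)\<^sup>2 + (v * int m)\<^sup>2 + (w * int m)\<^sup>2"
    by (simp add: n power_mult_distrib algebra_simps)
  then show ?thesis by blast
qed

section \<open>Integers of an imaginary quadratic field\<close>

definition quad_root :: "nat \<Rightarrow> complex" where
  "quad_root d = \<i> * of_real (sqrt (real d))"

text \<open>Half-integral coordinates treat all residues of \<open>d\<close> modulo 4 alike:
  integrality becomes the single condition that 4 divides A^2 + d B^2.\<close>

definition half_quad :: "nat \<Rightarrow> int \<Rightarrow> int \<Rightarrow> complex" where
  "half_quad d A B = (of_int A + of_int B * quad_root d) / 2"

lemma quad_root_square: "quad_root d * quad_root d = - of_nat d"
proof -
  have "sqrt (real d) * sqrt (real d) = real d" by simp
  then have "complex_of_real (sqrt (real d)) * complex_of_real (sqrt (real d)) = of_nat d"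
    by (metis of_real_mult of_real_of_nat_eq)
  then show ?thesis by (simp add: quad_root_def algebra_simps)
qed

lemma cnj_quad_root [simp]: "cnj (quad_root d) = - quad_root d"
  by (simp add: quad_root_def)

text \<open>A denominator v > 1 of \<open>x\<close> would make v^k divide \<open>D\<close> for all
  k, which already fails at k = D because 2^D > D.\<close>

lemma rat_in_Ints_if_powers_bounded_denominator:
  fixes x :: rat and D :: int
  assumes "D > 0" "\<And>k. of_int D * x ^ k \<in> \<int>"
  shows "x \<in> \<int>"
proof -
  obtain u v where x: "x = of_int u / of_int v" and v: "v > 0" "coprime u v"
    by (metis quotient_of_unique Fract_of_int_quotient fst_conv quotient_of_coprime quotient_of_div quotient_of_denom_pos surj_pair)
  have "v ^ k dvd D" for k
  proof -
    obtain m where "of_int D * x ^ k = of_int m" using assms(2) by (auto elim: Ints_cases)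
    then have "of_int (D * u ^ k) = (of_int (m * v ^ k) :: rat)" using v by (simp add: x power_divide field_simps)
    then have "D * u ^ k = m * v ^ k" by (simp only: of_int_eq_iff)
    then have "v ^ k dvd D * u ^ k" by simp
    moreover have "coprime (v ^ k) (u ^ k)" using v by (simp add: coprime_commute)
    ultimately show ?thesis by (simp add: coprime_dvd_mult_left_iff)
  qed
  from this[of "nat D"] have le: "v ^ nat D \<le> D" using assms(1) by (rule zdvd_imp_le)
  have "v = 1"
  proof (rule ccontr)
    assume "v \<noteq> 1"
    then have "2 ^ nat D \<le> v ^ nat D" using v by (intro power_mono) auto
    moreover have "int (nat D) < 2 ^ nat D" by (metis less_exp of_nat_less_iff of_nat_numeral of_nat_power)
    ultimately show False using le assms(1) by simp
  qed
  then show ?thesis by (simp add: x)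
qed

lemma rat_in_Ints_if_squarefree_mult_square:
  fixes x :: rat
  assumes "squarefree d" "of_nat d * x\<^sup>2 \<in> \<int>"
  shows "x \<in> \<int>"
proof -
  obtain u v where x: "x = of_int u / of_int v" and v: "v > 0" "coprime u v"
    by (metis quotient_of_unique Fract_of_int_quotient fst_conv quotient_of_coprime quotient_of_div quotient_of_denom_pos surj_pair)
  obtain m where "of_nat d * x\<^sup>2 = of_int m" using assms(2) by (auto elim: Ints_cases)
  then have "of_int (int d * u\<^sup>2) = (of_int (m * v\<^sup>2) :: rat)" using v by (simp add: x power_divide field_simps)
  then have "int d * u\<^sup>2 = m * v\<^sup>2" by (simp only: of_int_eq_iff)
  then have "v\<^sup>2 dvd int d * u\<^sup>2" by simp
  moreover have "coprime (v\<^sup>2) (u\<^sup>2)" using v by (simp add: coprime_commute)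
  ultimately have "v\<^sup>2 dvd int d" by (simp add: coprime_dvd_mult_left_iff)
  then have "(nat v)\<^sup>2 dvd d" using v by (metis int_dvd_int_iff int_nat_eq of_nat_power order_less_imp_le)
  then have "nat v = 1" using assms(1) by (simp add: squarefree_def)
  then have "v = 1" by simp
  then show ?thesis by (simp add: x)
qed

text \<open>The order Z[sqrt(-d)], possibly smaller than the ring of integers; it serves to express
  bounded denominators.\<close>

definition quad_order :: "nat \<Rightarrow> complex set" where
  "quad_order d = {of_int a + of_int b * quad_root d | a b. True}"

lemma quad_order_of_int: "of_int a \<in> quad_order d"
  unfolding quad_order_def by (force intro: exI[of _ a] exI[of _ 0])

lemma quad_order_add: "x \<in> quad_order d \<Longrightarrow> y \<in> quad_order d \<Longrightarrow> x + y \<in> quad_order d"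
  unfolding quad_order_def
proof safe
  fix a b a' b'
  have "of_int a + of_int b * quad_root d + (of_int a' + of_int b' * quad_root d) = of_int (a + a') + of_int (b + b') * quad_root d"
    by (simp add: algebra_simps)
  then show "\<exists>c e. of_int a + of_int b * quad_root d + (of_int a' + of_int b' * quad_root d) = of_int c + of_int e * quad_root d \<and> True"
    by blast
qed

lemma quad_order_mult: "x \<in> quad_order d \<Longrightarrow> y \<in> quad_order d \<Longrightarrow> x * y \<in> quad_order d"
  unfolding quad_order_def
proof safe
  fix a b a' b'
  have "(of_int a + of_int b * quad_root d) * (of_int a' + of_int b' * quad_root d)
      = of_int a * of_int a' + of_int b * of_int b' * (quad_root d * quad_root d) + (of_int a * of_int b' + of_int b * of_int a') * quad_root d"
    by (simp add: algebra_simps)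
  also have "\<dots> = of_int (a * a' - b * b' * int d) + of_int (a * b' + b * a') * quad_root d"
    unfolding quad_root_square by simp
  finally show "\<exists>c e. (of_int a + of_int b * quad_root d) * (of_int a' + of_int b' * quad_root d) = of_int c + of_int e * quad_root d \<and> True"
    by blast
qed

lemma quad_order_sum: "(\<And>i. i \<in> S \<Longrightarrow> f i \<in> quad_order d) \<Longrightarrow> sum f S \<in> quad_order d"
proof (induction S rule: infinite_finite_induct)
  case (insert i S)
  then show ?case by (simp add: quad_order_add)
qed (use quad_order_of_int[of 0] in auto)

lemma quad_order_power: "x \<in> quad_order d \<Longrightarrow> x ^ k \<in> quad_order d"
  by (induction k) (use quad_order_of_int[of 1] quad_order_mult in auto)

text \<open>The powers of an integral element have a common denominator; a rational number with this property is an integer.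
  Applied to the norms of \<open>z\<close> and \<open>z + 1\<close>, this shows that norm and trace of \<open>z\<close> are integers.\<close>
lemma integral_powers_bounded_denominator:
  assumes z: "of_nat e * z \<in> quad_order d" and q: "lead_coeff q = 1" "poly (map_poly of_int q) z = 0"
  shows "of_nat (e ^ degree q) * z ^ k \<in> quad_order d"
proof (induction k rule: less_induct)
  case (less k)
  define m where "m = degree q"
  show ?case
  proof (cases "k \<le> m")
    case True
    then have "of_nat (e ^ m) * z ^ k = of_nat (e ^ (m - k)) * (of_nat e * z) ^ k"
      by (simp add: power_mult_distrib flip: power_add mult.assoc)
    then show ?thesis unfolding m_def[symmetric]
      using quad_order_mult[OF quad_order_of_int[of "int (e ^ (m - k))"] quad_order_power[OF z, of k]] by simp
  next
    case False
    have "(\<Sum>i\<le>m. of_int (Polynomial.coeff q i) * z ^ i) = 0"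
      using q(2) by (simp add: poly_altdef m_def degree_map_poly coeff_map_poly)
    then have "z ^ m = - (\<Sum>i<m. of_int (Polynomial.coeff q i) * z ^ i)"
      using q(1) by (simp add: lessThan_Suc_atMost[symmetric] m_def add_eq_0_iff)
    \<comment> \<open>The monic equation expresses z^k through lower powers with integer
      coefficients, so no new denominator arises.\<close>
    then have "of_nat (e ^ m) * z ^ (k - m) * z ^ m = (\<Sum>i<m. of_int (- Polynomial.coeff q i) * (of_nat (e ^ m) * z ^ (k - m + i)))"
      by (simp add: sum_distrib_left sum_negf power_add mult_ac)
    moreover have "z ^ (k - m) * z ^ m = z ^ k" using False by (simp flip: power_add)
    moreover have "(\<Sum>i<m. of_int (- Polynomial.coeff q i) * (of_nat (e ^ m) * z ^ (k - m + i))) \<in> quad_order d"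
    proof (rule quad_order_sum)
      fix i assume "i \<in> {..<m}"
      then have "of_nat (e ^ m) * z ^ (k - m + i) \<in> quad_order d"
        using less[of "k - m + i"] False unfolding m_def[symmetric] by simp
      then show "of_int (- Polynomial.coeff q i) * (of_nat (e ^ m) * z ^ (k - m + i)) \<in> quad_order d"
        by (rule quad_order_mult[OF quad_order_of_int])
    qed
    ultimately show ?thesis unfolding m_def[symmetric] by (simp add: mult.assoc)
  qed
qed

text \<open>The product of \<open>D * z ^ k\<close> with its conjugate shows that
  \<open>D * D\<close> is a common denominator of all powers of the norm.\<close>

lemma norm_in_Ints_if_bounded_denominator:
  fixes a b :: rat
  assumes D: "D > 0" and z: "z = of_rat a + of_rat b * quad_root d" and pow: "\<And>k. of_nat D * z ^ k \<in> quad_order d"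
  shows "a\<^sup>2 + of_nat d * b\<^sup>2 \<in> \<int>"
proof (rule rat_in_Ints_if_powers_bounded_denominator)
  show "int (D * D) > 0" using D by simp
  fix k
  obtain u v where uv: "of_nat D * z ^ k = of_int u + of_int v * quad_root d"
    using pow[of k] by (auto simp: quad_order_def)
  have cnj_rat: "cnj (of_rat x) = of_rat x" for x
  proof -
    obtain i j where "x = of_int i / of_int j" by (metis quotient_of_div surj_pair)
    then show ?thesis by (simp add: of_rat_divide)
  qed
  have "z * cnj z = of_rat a * of_rat a - of_rat b * of_rat b * (quad_root d * quad_root d)"
    unfolding z by (simp add: cnj_rat algebra_simps)
  also have "\<dots> = of_rat (a\<^sup>2 + of_nat d * b\<^sup>2)"
    unfolding quad_root_square by (simp add: of_rat_add of_rat_mult power2_eq_square)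
  finally have N: "z * cnj z = of_rat (a\<^sup>2 + of_nat d * b\<^sup>2)" .
  have "of_rat (of_int (int (D * D)) * (a\<^sup>2 + of_nat d * b\<^sup>2) ^ k) = of_nat D * of_nat D * (z * cnj z) ^ k"
    unfolding N by (simp add: of_rat_mult of_rat_power)
  also have "\<dots> = (of_nat D * z ^ k) * cnj (of_nat D * z ^ k)"
    by (simp add: power_mult_distrib mult_ac)
  also have "\<dots> = of_int u * of_int u - of_int v * of_int v * (quad_root d * quad_root d)"
    unfolding uv by (simp add: algebra_simps)
  also have "\<dots> = of_rat (of_int (u * u + v * v * int d))"
    unfolding quad_root_square by (simp add: of_rat_add of_rat_mult)
  finally have "of_int (int (D * D)) * (a\<^sup>2 + of_nat d * b\<^sup>2) ^ k = of_int (u * u + v * v * int d)"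
    by (simp only: of_rat_eq_iff)
  then show "of_int (int (D * D)) * (a\<^sup>2 + of_nat d * b\<^sup>2) ^ k \<in> \<int>" by simp
qed

lemma ring_of_integers_iff:
  assumes d: "squarefree d"
  shows "z \<in> ring_of_integers d \<longleftrightarrow> (\<exists>A B. z = half_quad d A B \<and> 4 dvd A\<^sup>2 + int d * B\<^sup>2)"
proof
  assume "z \<in> ring_of_integers d"
  then obtain a b :: rat and q where z: "z = of_rat a + of_rat b * quad_root d"
    and q: "lead_coeff q = 1" "poly (map_poly of_int q) z = 0"
    by (auto simp: ring_of_integers_def qfield_def quad_root_def)
  obtain u v where u: "a = of_int u / of_int v" "v > 0" by (metis quotient_of_div quotient_of_denom_pos surj_pair)
  obtain u' v' where u': "b = of_int u' / of_int v'" "v' > 0" by (metis quotient_of_div quotient_of_denom_pos surj_pair)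
  define e where "e = nat (v * v')"
  have e: "e > 0" "of_nat e = of_int v * (of_int v' :: complex)"
    using u u' by (simp_all add: e_def flip: of_int_mult)
  have "of_nat e * z = of_int (v' * u) + of_int (v * u') * quad_root d"
    using u(2) u'(2) unfolding e z u u' by (simp add: of_rat_divide field_simps)
  then have "of_nat e * z \<in> quad_order d" unfolding quad_order_def by blast
  then have pow: "of_nat (e ^ degree q) * z ^ k \<in> quad_order d" for k
    using integral_powers_bounded_denominator q by blast
  have N: "a\<^sup>2 + of_nat d * b\<^sup>2 \<in> \<int>"
    using norm_in_Ints_if_bounded_denominator[OF _ z pow] e by simp
  have "z + 1 = of_rat (a + 1) + of_rat b * quad_root d" by (simp add: z of_rat_add)
  moreover have "of_nat (e ^ degree q) * (z + 1) ^ k \<in> quad_order d" for k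
  proof -
    have "of_nat (e ^ degree q) * (z + 1) ^ k = (\<Sum>i\<le>k. of_int (int (k choose i)) * (of_nat (e ^ degree q) * z ^ i))"
      by (simp add: binomial_ring sum_distrib_left mult_ac)
    also have "\<dots> \<in> quad_order d"
      by (intro quad_order_sum quad_order_mult quad_order_of_int pow)
    finally show ?thesis .
  qed
  ultimately have "(a + 1)\<^sup>2 + of_nat d * b\<^sup>2 \<in> \<int>"
    using norm_in_Ints_if_bounded_denominator e by (metis zero_less_power)
  then have "((a + 1)\<^sup>2 + of_nat d * b\<^sup>2) - (a\<^sup>2 + of_nat d * b\<^sup>2) - 1 \<in> \<int>" using N by (intro Ints_diff) auto
  \<comment> \<open>The norms of z + 1 and z differ by the trace plus 1.\<close>
  then have "2 * a \<in> \<int>" by (simp add: power2_eq_square algebra_simps)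
  then obtain A where A: "2 * a = of_int A" by (auto elim: Ints_cases)
  obtain m where m: "a\<^sup>2 + of_nat d * b\<^sup>2 = of_int m" using N by (auto elim: Ints_cases)
  have "of_nat d * (2 * b)\<^sup>2 = 4 * (a\<^sup>2 + of_nat d * b\<^sup>2) - (2 * a)\<^sup>2"
    by (simp add: power_mult_distrib algebra_simps)
  also have "\<dots> = of_int (4 * m - A\<^sup>2)" unfolding m A by simp
  finally have "of_nat d * (2 * b)\<^sup>2 \<in> \<int>" by simp
  then have "2 * b \<in> \<int>" by (rule rat_in_Ints_if_squarefree_mult_square[OF d])
  then obtain B where B: "2 * b = of_int B" by (auto elim: Ints_cases)
  have "z = half_quad d A B"
  proof -
    have ab: "a = of_int A / 2" "b = of_int B / 2" using A B by simp_all
    show ?thesis unfolding z half_quad_def ab by (simp add: of_rat_divide add_divide_distrib)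
  qed
  moreover have "A\<^sup>2 + int d * B\<^sup>2 = 4 * m"
  proof -
    have "of_int (A\<^sup>2 + int d * B\<^sup>2) = (2 * a)\<^sup>2 + of_nat d * (2 * b)\<^sup>2" unfolding A B by simp
    also have "\<dots> = 4 * (a\<^sup>2 + of_nat d * b\<^sup>2)" by (simp add: power_mult_distrib algebra_simps)
    also have "\<dots> = of_int (4 * m)" unfolding m by simp
    finally have "of_int (A\<^sup>2 + int d * B\<^sup>2) = (of_int (4 * m) :: rat)" .
    then show ?thesis by (simp only: of_int_eq_iff)
  qed
  ultimately show "\<exists>A B. z = half_quad d A B \<and> 4 dvd A\<^sup>2 + int d * B\<^sup>2" by (metis dvd_triv_left)
next
  assume "\<exists>A B. z = half_quad d A B \<and> 4 dvd A\<^sup>2 + int d * B\<^sup>2"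
  then obtain A B m where z: "z = half_quad d A B" and m: "A\<^sup>2 + int d * B\<^sup>2 = 4 * m" by (auto simp: dvd_def)
  have "z = of_rat (of_int A / 2) + of_rat (of_int B / 2) * (\<i> * of_real (sqrt (real d)))"
    by (simp add: z half_quad_def quad_root_def of_rat_divide field_simps)
  then have "z \<in> qfield d" unfolding qfield_def by blast
  moreover have "poly (map_poly of_int [:m, -A, 1:]) z = 0"
  proof -
    have h: "of_int A + of_int B * quad_root d = 2 * z" by (simp add: z half_quad_def)
    have "4 * z * z = (of_int A + of_int B * quad_root d) * (of_int A + of_int B * quad_root d)"
      unfolding h by simp
    also have "\<dots> = 2 * of_int A * (of_int A + of_int B * quad_root d) - of_int A * of_int A
        + of_int B * of_int B * (quad_root d * quad_root d)"
      by (simp add: algebra_simps)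
    also have "\<dots> = 4 * of_int A * z - of_int (A\<^sup>2 + int d * B\<^sup>2)"
      unfolding h quad_root_square by (simp add: power2_eq_square algebra_simps)
    finally have "4 * (z * z - of_int A * z + of_int m) = 0" unfolding m by (simp add: algebra_simps)
    then have "z * z - of_int A * z + of_int m = 0" by (simp only: mult_eq_0_iff) simp
    then show ?thesis by (simp add: map_poly_pCons algebra_simps)
  qed
  ultimately show "z \<in> ring_of_integers d" unfolding ring_of_integers_def
    by (auto intro!: exI[of _ "[:m, -A, 1:]"])
qed

text \<open>Dividing each coordinate by \<open>p\<close> turns the total norm p r into p r / p^2 = r
  / p; injectivity comes from a single nonzero \<open>y j\<close>.\<close>

lemma represented_by_I4_of_norm_sum:
  fixes y :: "nat \<Rightarrow> complex"
  assumes "p > 0" "r > 0" and sum: "(\<Sum>i<4. y i * cnj (y i)) = of_nat (p * r)"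
    and int: "\<And>x i. x \<in> P \<Longrightarrow> i < 4 \<Longrightarrow> x * cnj (y i) / of_nat p \<in> R"
  shows "unary_represented_by_I4 R P (real r / real p)"
proof -
  define f where "f = (\<lambda>x i. x * cnj (y i) / of_nat p)"
  have "\<exists>i<4. y i \<noteq> 0"
  proof (rule ccontr)
    assume "\<not> ?thesis"
    then have "(\<Sum>i<4. y i * cnj (y i)) = 0" by (intro sum.neutral) auto
    then show False using sum assms(1,2) by (simp del: of_nat_mult)
  qed
  then obtain j where j: "j < 4" "y j \<noteq> 0" by blast
  have inj: "x = x'" if "f x j = f x' j" for x x'
    using that j assms(1) by (simp add: f_def)
  have "(\<Sum>i<4. f x i * cnj (f x' i)) = x * cnj x' * of_real (real r / real p)" for x x'
  proof -
    have "(\<Sum>i<4. f x i * cnj (f x' i)) = (\<Sum>i<4. x * cnj x' / (of_nat p * of_nat p) * (y i * cnj (y i)))"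
      unfolding f_def by (intro sum.cong) (simp_all add: mult_ac)
    also have "\<dots> = x * cnj x' / (of_nat p * of_nat p) * of_nat (p * r)"
      unfolding sum[symmetric] by (rule sum_distrib_left[symmetric])
    also have "\<dots> = x * cnj x' * of_real (real r / real p)" using assms(1) by (simp add: field_simps)
    finally show ?thesis .
  qed
  moreover have "\<forall>x\<in>P. \<forall>x'\<in>P. (\<forall>i<4. f x i = f x' i) \<longrightarrow> x = x'" using inj j(1) by blast
  moreover have "\<forall>x\<in>P. \<forall>i<4. f x i \<in> R" using int by (simp add: f_def)
  moreover have "f (x + x') i = f x i + f x' i" "f (a * x) i = a * f x i" for x x' a i
    by (simp_all add: f_def add_divide_distrib distrib_right)
  ultimately show ?thesis unfolding unary_represented_by_I4_def by (intro exI[of _ f]) simp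
qed

section \<open>Sums of three norms\<close>

lemma exists_small_solution:
  fixes p :: nat and g c :: int
  assumes p: "prime p" "odd p" and g: "\<not> int p dvd g"
  shows "\<exists>a. int p dvd c - g * a \<and> \<bar>2 * a\<bar> \<le> int p - 1"
proof -
  have "coprime g (int p)" using p g by (metis coprime_commute prime_imp_coprime prime_nat_int_transfer)
  then obtain g' where "[g * g' = 1] (mod int p)" using cong_solve_coprime_int by blast
  then have "int p dvd g * g' - 1" by (simp add: cong_iff_dvd_diff)
  moreover obtain k where k: "\<bar>2 * (g' * c + k * int p)\<bar> \<le> int p"
    using exists_nearest_multiple[of "int p"] p prime_gt_0_nat by force
  moreover have "c - g * (g' * c + k * int p) = - (c * (g * g' - 1)) - int p * (g * k)" by (simp add: algebra_simps)
  ultimately have "int p dvd c - g * (g' * c + k * int p)" by simp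
  \<comment> \<open>An even number cannot equal the odd \<open>p\<close>, which sharpens the bound
    from p to p - 1.\<close>
  moreover have "\<bar>2 * (g' * c + k * int p)\<bar> \<noteq> int p"
  proof
    assume *: "\<bar>2 * (g' * c + k * int p)\<bar> = int p"
    have "even \<bar>2 * (g' * c + k * int p)\<bar>" by simp
    then show False unfolding * using p by simp
  qed
  ultimately show ?thesis using k by (intro exI[of _ "g' * c + k * int p"]) auto
qed

lemma three_squares_int:
  fixes t :: int
  assumes "t \<ge> 0" "t mod 4 = 1 \<or> t mod 4 = 2"
  shows "\<exists>u v w. t = u\<^sup>2 + v\<^sup>2 + w\<^sup>2"
proof -
  have "int (nat t mod 4) = t mod 4" using assms by (simp add: zmod_int)
  then have "nat t mod 4 = 1 \<or> nat t mod 4 = 2" using assms by auto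
  from three_squares[OF this] show ?thesis using assms(1) by simp
qed

text \<open>One of t, t - d, t - 2d is 1 or 2 modulo 4 and hence a sum of three squares; each
  \<open>d\<close> subtracted is restored by setting \<open>u\<close> or \<open>v\<close> to
  1.\<close>

lemma three_norms_even_discriminant:
  fixes t :: int and d :: nat
  assumes d: "d mod 4 = 1 \<or> d mod 4 = 2" and t: "t \<ge> 2 * int d"
  shows "\<exists>x y z u v. t = (x\<^sup>2 + int d * u\<^sup>2) + (y\<^sup>2 + int d * v\<^sup>2) + z\<^sup>2"
proof -
  have "(t mod 4 = 1 \<or> t mod 4 = 2) \<or> ((t - int d) mod 4 = 1 \<or> (t - int d) mod 4 = 2)
      \<or> ((t - 2 * int d) mod 4 = 1 \<or> (t - 2 * int d) mod 4 = 2)"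
    using d by presburger
  then consider "t mod 4 = 1 \<or> t mod 4 = 2" | "(t - int d) mod 4 = 1 \<or> (t - int d) mod 4 = 2"
    | "(t - 2 * int d) mod 4 = 1 \<or> (t - 2 * int d) mod 4 = 2" by blast
  then show ?thesis
  proof cases
    case 1
    then obtain x y z where "t = x\<^sup>2 + y\<^sup>2 + z\<^sup>2" using three_squares_int[of t] t by auto
    then have "t = (x\<^sup>2 + int d * 0\<^sup>2) + (y\<^sup>2 + int d * 0\<^sup>2) + z\<^sup>2" by simp
    then show ?thesis by blast
  next
    case 2
    then obtain x y z where "t - int d = x\<^sup>2 + y\<^sup>2 + z\<^sup>2" using three_squares_int[of "t - int d"] t by auto
    then have "t = (x\<^sup>2 + int d * 1\<^sup>2) + (y\<^sup>2 + int d * 0\<^sup>2) + z\<^sup>2" by simp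
    then show ?thesis by blast
  next
    case 3
    then obtain x y z where "t - 2 * int d = x\<^sup>2 + y\<^sup>2 + z\<^sup>2" using three_squares_int[of "t - 2 * int d"] t by auto
    then have "t = (x\<^sup>2 + int d * 1\<^sup>2) + (y\<^sup>2 + int d * 1\<^sup>2) + z\<^sup>2" by simp
    then show ?thesis by blast
  qed
qed

text \<open>Exactly one of the three squares summing to \<open>4 t + 1\<close> is odd.\<close>
lemma pronic_plus_two_squares:
  fixes t :: int
  assumes "t \<ge> 0"
  shows "\<exists>x y z. t = x\<^sup>2 + x + y\<^sup>2 + z\<^sup>2"
proof -
  have "(4 * t + 1) mod 4 = 1" by presburger
  then obtain u v w where uvw: "4 * t + 1 = u\<^sup>2 + v\<^sup>2 + w\<^sup>2" using three_squares_int[of "4 * t + 1"] assms by auto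
  have ex: "\<exists>x y z. t = x\<^sup>2 + x + y\<^sup>2 + z\<^sup>2" if "odd a" "even b" "even c" "4 * t + 1 = a\<^sup>2 + b\<^sup>2 + c\<^sup>2" for a b c
  proof -
    obtain x y z where "a = 2 * x + 1" "b = 2 * y" "c = 2 * z" using \<open>odd a\<close> \<open>even b\<close> \<open>even c\<close> by (auto elim!: oddE evenE)
    then have "4 * t + 1 = 4 * (x\<^sup>2 + x + y\<^sup>2 + z\<^sup>2) + 1" using that(4) by (simp add: power2_eq_square algebra_simps)
    then have "t = x\<^sup>2 + x + y\<^sup>2 + z\<^sup>2" by (simp only: add_right_cancel mult_cancel_left) simp
    then show ?thesis by blast
  qed
  have sq: "a\<^sup>2 mod 4 = (if even a then 0 else 1)" for a :: int
  proof (cases "even a")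
    case True
    then show ?thesis by (auto elim!: evenE simp: power2_eq_square)
  next
    case False
    then obtain b where "a = 2 * b + 1" by (auto elim: oddE)
    then have *: "a\<^sup>2 = 4 * (b\<^sup>2 + b) + 1" by (simp add: power2_eq_square algebra_simps)
    have "(4 * c + 1) mod 4 = 1" for c :: int by presburger
    then have "a\<^sup>2 mod 4 = 1" by (simp only: *)
    then show ?thesis using False by simp
  qed
  have "(u\<^sup>2 mod 4 + v\<^sup>2 mod 4 + w\<^sup>2 mod 4) mod 4 = 1"
  proof -
    have "(a mod 4 + b mod 4 + c mod 4) mod 4 = (a + b + c) mod 4" for a b c :: int
      by (metis mod_add_eq mod_add_left_eq)
    then show ?thesis using \<open>(4 * t + 1) mod 4 = 1\<close> unfolding uvw by (simp only:)
  qed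
  then consider "odd u" "even v" "even w" | "odd v" "even u" "even w" | "odd w" "even u" "even v"
    unfolding sq by (auto split: if_splits)
  then show ?thesis
  proof cases
    case 1
    then show ?thesis using ex[of u v w] uvw by simp
  next
    case 2
    then show ?thesis using ex[of v u w] uvw by simp
  next
    case 3
    then show ?thesis using ex[of w u v] uvw by simp
  qed
qed

section \<open>Representations of a split prime ideal\<close>

text \<open>Splitting is implied: an odd \<open>p\<close> not dividing \<open>d\<close> is
  unramified, and an inert \<open>p\<close> would make \<open>P\<close> the principal ideal
  generated by \<open>p\<close>.\<close>

locale split_prime_ideal =
  fixes d p :: nat and P :: "complex set"
  assumes squarefree_d: "squarefree d"
    and P: "prime_ideal (ring_of_integers d) P" and nonprincipal: "\<not> principal_ideal (ring_of_integers d) P"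
    and p: "prime p" "of_nat p \<in> P" "odd p" "\<not> p dvd d"
begin

abbreviation "OE \<equiv> ring_of_integers d"
abbreviation "w \<equiv> quad_root d"

lemmas O_iff = ring_of_integers_iff[OF squarefree_d]

lemma coprime_p: "coprime 4 (int p)" "coprime 2 (int p)"
proof -
  show c2: "coprime 2 (int p)" using p(3) by (simp add: coprime_left_2_iff_odd)
  then have "coprime (2 ^ 2) (int p)" by (subst coprime_power_left_iff) simp
  then show "coprime 4 (int p)" by simp
qed

lemma O_of_int: "of_int a \<in> OE"
  unfolding O_iff half_quad_def by (rule exI[of _ "2 * a"], rule exI[of _ 0]) (simp add: power_mult_distrib)

lemma O_quad: "of_int a + of_int b * w \<in> OE"
  unfolding O_iff half_quad_def
  by (rule exI[of _ "2 * a"], rule exI[of _ "2 * b"]) (auto simp: power_mult_distrib add_divide_distrib)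

lemma half_quad_half: "half_quad d A B * 2 = of_int A + of_int B * w"
  by (simp add: half_quad_def)

lemma P_sub: "x \<in> P \<Longrightarrow> x \<in> OE" and P_add: "x \<in> P \<Longrightarrow> y \<in> P \<Longrightarrow> x + y \<in> P"
  and P_mult: "a \<in> OE \<Longrightarrow> x \<in> P \<Longrightarrow> a * x \<in> P"
  using P by (auto simp: prime_ideal_def is_ideal_def)

lemma P_diff: "x \<in> P \<Longrightarrow> y \<in> P \<Longrightarrow> x - y \<in> P"
  using P_add[of x "of_int (-1) * y"] P_mult[OF O_of_int[of "-1"], of y] by simp

lemma P_int: "of_int a * x \<in> P" if "x \<in> P" using P_mult[OF O_of_int that] .

text \<open>Otherwise a Bezout relation with \<open>p\<close> would put 1 into
  \<open>P\<close>.\<close>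

lemma dvd_if_of_int_mem:
  assumes "of_int c \<in> P"
  shows "int p dvd c"
proof (rule ccontr)
  assume "\<not> int p dvd c"
  then have "coprime c (int p)" using p(1) by (metis coprime_commute prime_imp_coprime prime_nat_int_transfer)
  then obtain u v where uv: "u * c + v * int p = 1" using bezout_int[of c "int p"] by auto
  have "of_int u * of_int c + of_int v * of_nat p \<in> P" using assms p(2) by (intro P_add P_int)
  also have "of_int u * of_int c + of_int v * of_nat p = (of_int (u * c + v * int p) :: complex)" by simp
  finally have "1 \<in> P" unfolding uv by simp
  then have "P = OE" using P_mult[of _ 1] P_sub by auto
  then show False using P by (simp add: prime_ideal_def)
qed

lemma half_quad_divide:
  assumes "4 dvd A\<^sup>2 + int d * B\<^sup>2" "int p dvd A" "int p dvd B"
  shows "half_quad d A B / of_nat p \<in> OE"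
proof -
  obtain a b where ab: "A = int p * a" "B = int p * b" using assms by (auto simp: dvd_def)
  have "A\<^sup>2 + int d * B\<^sup>2 = (int p)\<^sup>2 * (a\<^sup>2 + int d * b\<^sup>2)" unfolding ab by (simp add: power_mult_distrib algebra_simps)
  then have "4 dvd a\<^sup>2 + int d * b\<^sup>2" using assms(1) coprime_p by (simp add: coprime_dvd_mult_right_iff)
  moreover have "half_quad d A B / of_nat p = half_quad d a b"
    using prime_gt_0_nat[OF p(1)] unfolding half_quad_def ab by (simp add: field_simps)
  ultimately show ?thesis unfolding O_iff by blast
qed

text \<open>As \<open>P\<close> is not generated by \<open>p\<close>, it has an element not
  divisible by \<open>p\<close>. Its coefficient \<open>B\<close> is then prime to \<open>p\<close>:
  if \<open>p\<close> divided \<open>B\<close>, it would divide \<open>A\<close> too. Scaling by the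
  inverse of \<open>B\<close> modulo \<open>p\<close> and subtracting a multiple of
  \<open>p * w\<close> makes the coefficient of \<open>w\<close> equal to 1.\<close>

lemma exists_root_mem: "\<exists>c. of_int c + w \<in> P"
proof -
  have "\<exists>x\<in>P. x / of_nat p \<notin> OE"
  proof (rule ccontr)
    assume *: "\<not> ?thesis"
    have "P = (\<lambda>x. of_nat p * x) ` OE"
    proof (intro equalityI subsetI)
      fix x assume "x \<in> P"
      then show "x \<in> (\<lambda>x. of_nat p * x) ` OE" using * prime_gt_0_nat[OF p(1)] by (intro image_eqI[of _ _ "x / of_nat p"]) auto
    next
      fix x assume "x \<in> (\<lambda>x. of_nat p * x) ` OE"
      then show "x \<in> P" using P_mult p(2) by (auto simp: mult.commute)
    qed
    then show False using nonprincipal O_of_int[of "int p"] unfolding principal_ideal_def by auto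
  qed
  then obtain x where x: "x \<in> P" "x / of_nat p \<notin> OE" by blast
  obtain A B where "x = half_quad d A B" "4 dvd A\<^sup>2 + int d * B\<^sup>2"
    using P_sub[OF x(1)] unfolding O_iff by blast
  with x have AB: "half_quad d A B \<in> P" "4 dvd A\<^sup>2 + int d * B\<^sup>2" "half_quad d A B / of_nat p \<notin> OE"
    by simp_all
  have two: "of_int A + of_int B * w \<in> P" using P_int[OF AB(1), of 2] half_quad_half[of A B] by (simp add: mult.commute)
  have pw: "of_int (int p * c) * w \<in> P" for c
    using P_mult[OF O_quad[of 0 c] p(2)] by (simp add: mult_ac)
  have "\<not> int p dvd B"
  proof
    assume B: "int p dvd B"
    then have "of_int B * w \<in> P" using pw by (auto simp: dvd_def)
    then have "of_int A \<in> P" using P_diff[OF two] by fastforce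
    then show False using half_quad_divide[OF AB(2) dvd_if_of_int_mem B] AB(3) by blast
  qed
  then have "coprime B (int p)" using p(1) by (metis coprime_commute prime_imp_coprime prime_nat_int_transfer)
  then obtain t where "[B * t = 1] (mod int p)" using cong_solve_coprime_int by blast
  then obtain j where j: "B * t - 1 = int p * j" by (auto simp: cong_iff_dvd_diff dvd_def)
  have "of_int t * (of_int A + of_int B * w) - of_int (int p * j) * w \<in> P" by (intro P_diff P_int two pw)
  also have "of_int t * (of_int A + of_int B * w) - of_int (int p * j) * w = of_int (t * A) + w"
    unfolding j[symmetric] by (simp add: algebra_simps)
  finally show ?thesis by blast
qed

lemma root_dvd:
  assumes "of_int c + w \<in> P"
  shows "int p dvd c\<^sup>2 + int d"
proof (rule dvd_if_of_int_mem)
  have "(of_int c + of_int (-1) * w) * (of_int c + w) \<in> P" by (rule P_mult[OF O_quad assms])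
  also have "(of_int c + of_int (-1) * w) * (of_int c + w) = of_int c * of_int c - w * w" by (simp add: algebra_simps)
  also have "\<dots> = of_int (c\<^sup>2 + int d)" unfolding quad_root_square by (simp add: power2_eq_square)
  finally show "of_int (c\<^sup>2 + int d) \<in> P" .
qed

lemma root_mem_cong:
  assumes "of_int c + w \<in> P" "int p dvd c - c'"
  shows "of_int c' + w \<in> P"
proof -
  obtain k where k: "c - c' = int p * k" using assms(2) by (auto simp: dvd_def)
  have "of_int c + w - of_int k * of_nat p \<in> P" by (intro P_diff assms P_int p)
  also have "of_int c + w - of_int k * of_nat p = of_int (c - int p * k) + w" by simp
  also have "c - int p * k = c'" using k by simp
  finally show ?thesis .
qed

text \<open>Both \<open>n\<close> and the \<open>c\<close> supplied by \<open>P\<close> are square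
  roots of -d modulo \<open>p\<close>, so they agree up to a sign that depends on
  \<open>P\<close>.\<close>

lemma exists_signed_root:
  assumes n: "(int n ^ 2 + int d) mod int p = 0"
  shows "\<exists>\<nu>. \<bar>\<nu>\<bar> = int n \<and> of_int \<nu> + w \<in> P"
proof -
  obtain c where c: "of_int c + w \<in> P" using exists_root_mem by blast
  have "int p dvd (c\<^sup>2 + int d) - (int n ^ 2 + int d)" using root_dvd[OF c] n by (intro dvd_diff) auto
  also have "(c\<^sup>2 + int d) - (int n ^ 2 + int d) = (c - int n) * (c - (- int n))" by (simp add: power2_eq_square algebra_simps)
  finally have "int p dvd c - int n \<or> int p dvd c - (- int n)" using p(1) by (simp add: prime_dvd_mult_iff)
  then show ?thesis using root_mem_cong[OF c, of "int n"] root_mem_cong[OF c, of "- int n"] by (metis abs_minus_cancel abs_of_nat)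
qed

text \<open>An even \<open>A\<close> with an odd \<open>B\<close> would force 4 to divide the
  squarefree \<open>d\<close>.\<close>

lemma same_parity:
  assumes "4 dvd A\<^sup>2 + int d * B\<^sup>2"
  shows "even A \<and> even B \<or> odd A \<and> odd B \<and> odd d"
proof (cases "even A")
  case True
  have "even B"
  proof (rule ccontr)
    assume "odd B"
    have "4 dvd A\<^sup>2" using True by (auto elim!: evenE simp: power2_eq_square)
    then have "4 dvd int d * B\<^sup>2" using assms by (simp add: dvd_add_right_iff)
    moreover have "coprime (2 ^ 2) (B\<^sup>2)" using \<open>odd B\<close>
      by (simp only: coprime_power_left_iff coprime_power_right_iff) (simp add: coprime_left_2_iff_odd)
    ultimately have "4 dvd int d" by (simp add: coprime_dvd_mult_left_iff)
    then have "int 4 dvd int d" by simp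
    then have "2 ^ 2 dvd d" by (simp only: int_dvd_int_iff) simp
    then show False using squarefree_d unfolding squarefree_def by (metis nat_dvd_1_iff_1 numeral_eq_one_iff semiring_norm(85))
  qed
  then show ?thesis using True by simp
next
  case False
  have "even (A\<^sup>2 + int d * B\<^sup>2)" using assms by (meson dvd_trans even_numeral)
  then show ?thesis using False by simp
qed

text \<open>Elements of \<open>P\<close> satisfy A = B \<nu> modulo \<open>p\<close>. Hence A A' + d
  B B' is congruent to B B' (\<nu>^2 + d), which vanishes modulo \<open>p\<close>, and so does B A'
  - A B'. Parity and multiplicativity of the norm take care of the denominator 2.\<close>

lemma mult_cnj_divide:
  assumes x: "x \<in> P" and y: "y \<in> P"
  shows "x * cnj y / of_nat p \<in> OE"
proof -
  obtain \<nu> where \<nu>: "of_int \<nu> + w \<in> P" using exists_root_mem by blast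
  obtain A B where A: "x = half_quad d A B" "4 dvd A\<^sup>2 + int d * B\<^sup>2" using P_sub[OF x] O_iff by blast
  obtain A' B' where A': "y = half_quad d A' B'" "4 dvd A'\<^sup>2 + int d * B'\<^sup>2" using P_sub[OF y] O_iff by blast
  have cong: "int p dvd A - B * \<nu>" if "half_quad d A B \<in> P" for A B
  proof (rule dvd_if_of_int_mem)
    have "of_int 2 * half_quad d A B - of_int B * (of_int \<nu> + w) \<in> P" by (intro P_diff P_int that \<nu>)
    also have "of_int 2 * half_quad d A B - of_int B * (of_int \<nu> + w) = of_int (A - B * \<nu>)"
      using half_quad_half[of A B] by (simp add: algebra_simps)
    finally show "of_int (A - B * \<nu>) \<in> P" .
  qed
  obtain k where k: "A = B * \<nu> + int p * k" using cong x A by (metis diff_eq_eq dvd_def add.commute)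
  obtain k' where k': "A' = B' * \<nu> + int p * k'" using cong y A' by (metis diff_eq_eq dvd_def add.commute)
  define U V where "U = A * A' + int d * B * B'" and "V = B * A' - A * B'"
  have "U = B * B' * (\<nu>\<^sup>2 + int d) + int p * (B * \<nu> * k' + B' * \<nu> * k + int p * k * k')"
    unfolding U_def k k' by (simp add: power2_eq_square algebra_simps)
  then have pU: "int p dvd U" using root_dvd[OF \<nu>] by simp
  have "V = int p * (B * k' - k * B')" unfolding V_def k k' by (simp add: algebra_simps)
  then have pV: "int p dvd V" by simp
  have "even U" "even V"
    using same_parity[OF A(2)] same_parity[OF A'(2)] unfolding U_def V_def by auto
  then obtain u v where uv: "U = 2 * u" "V = 2 * v" by (auto elim!: evenE)
  have "x * cnj y = half_quad d u v"
  proof -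
    have "x * cnj y = (of_int A * of_int A' - of_int B * of_int B' * (w * w) + of_int (B * A' - A * B') * w) / 4"
      unfolding A A' half_quad_def by (simp add: algebra_simps add_divide_distrib diff_divide_distrib)
    also have "\<dots> = (of_int U + of_int V * w) / 4"
      unfolding quad_root_square U_def V_def by (simp add: mult_ac)
    also have "\<dots> = half_quad d u v" unfolding uv half_quad_def by (simp add: add_divide_distrib)
    finally show ?thesis .
  qed
  moreover have "4 dvd u\<^sup>2 + int d * v\<^sup>2"
  proof -
    obtain N N' where N: "A\<^sup>2 + int d * B\<^sup>2 = 4 * N" "A'\<^sup>2 + int d * B'\<^sup>2 = 4 * N'" using A A' by (auto simp: dvd_def)
    have "4 * (u\<^sup>2 + int d * v\<^sup>2) = U\<^sup>2 + int d * V\<^sup>2" unfolding uv by (simp add: power_mult_distrib)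
    also have "\<dots> = (A\<^sup>2 + int d * B\<^sup>2) * (A'\<^sup>2 + int d * B'\<^sup>2)"
      unfolding U_def V_def by (simp add: power2_eq_square algebra_simps)
    also have "\<dots> = 4 * (4 * (N * N'))" unfolding N by simp
    finally have "u\<^sup>2 + int d * v\<^sup>2 = 4 * (N * N')" by (simp only: mult_cancel_left) simp
    then show ?thesis by (metis dvd_triv_left)
  qed
  moreover have "int p dvd u" "int p dvd v"
    using pU pV coprime_p(2) unfolding uv by (simp_all add: coprime_dvd_mult_right_iff coprime_commute)
  ultimately show ?thesis using half_quad_divide by simp
qed

lemma represented:
  fixes y :: "nat \<Rightarrow> complex"
  assumes "r > 0" "\<And>i. i < 4 \<Longrightarrow> y i \<in> P" "(\<Sum>i<4. y i * cnj (y i)) = of_nat (p * r)"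
  shows "unary_represented_by_I4 OE P (real r / real p)"
  using represented_by_I4_of_norm_sum[OF prime_gt_0_nat[OF p(1)] assms(1,3)] assms(2) mult_cnj_divide by blast

end

section \<open>Norm computations and the bound on r\<close>

lemma sum_lessThan_4: "(\<Sum>i<4. f i) = f 0 + f 1 + f 2 + f (3::nat)" for f :: "nat \<Rightarrow> complex"
  by (simp add: eval_nat_numeral)

context split_prime_ideal
begin

lemma norm_quad: "(of_int a + of_int b * w) * cnj (of_int a + of_int b * w) = of_int (a\<^sup>2 + int d * b\<^sup>2)"
proof -
  have "(of_int a + of_int b * w) * cnj (of_int a + of_int b * w) = of_int a * of_int a - of_int b * of_int b * (w * w)"
    by (simp add: algebra_simps)
  then show ?thesis unfolding quad_root_square by (simp add: power2_eq_square)
qed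

lemma norm_half_quad:
  assumes "A\<^sup>2 + int d * B\<^sup>2 = 4 * N"
  shows "half_quad d A B * cnj (half_quad d A B) = of_int N"
proof -
  have "half_quad d A B * cnj (half_quad d A B) = of_int (A\<^sup>2 + int d * B\<^sup>2) / 4"
    unfolding norm_quad[symmetric] half_quad_def by simp
  then show ?thesis unfolding assms by simp
qed

lemma norm_scale: "(of_nat p * x) * cnj (of_nat p * x) = of_int ((int p)\<^sup>2) * (x * cnj x)"
  by (simp add: power2_eq_square)

lemma represented_by_norms:
  assumes "r > 0" "\<And>x. x \<in> {y0, y1, y2, y3} \<Longrightarrow> x \<in> P"
    and "y0 * cnj y0 = of_int N0" "y1 * cnj y1 = of_int N1" "y2 * cnj y2 = of_int N2" "y3 * cnj y3 = of_int N3"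
    and "N0 + N1 + N2 + N3 = int p * int r"
  shows "unary_represented_by_I4 OE P (real r / real p)"
proof (rule represented)
  define y where "y = (\<lambda>i::nat. if i = 0 then y0 else if i = 1 then y1 else if i = 2 then y2 else y3)"
  show "y i \<in> P" if "i < 4" for i using assms(2) by (simp add: y_def)
  have "(\<Sum>i<4. y i * cnj (y i)) = of_int (N0 + N1 + N2 + N3)"
    unfolding sum_lessThan_4 using assms(3-6) by (simp add: y_def)
  then show "(\<Sum>i<4. y i * cnj (y i)) = of_nat (p * r)" unfolding assms(7) by simp
qed (rule assms(1))

lemma P_scale: "x \<in> OE \<Longrightarrow> of_nat p * x \<in> P"
  using P_mult[OF _ p(2), of x] by (simp add: mult.commute)

lemma not_dvd_root:
  assumes "int p dvd \<nu>\<^sup>2 + int d"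
  shows "\<not> int p dvd \<nu>"
proof
  assume "int p dvd \<nu>"
  then have "int p dvd \<nu>\<^sup>2" by (simp add: power2_eq_square)
  then have "int p dvd int d" using assms by (simp add: dvd_add_right_iff)
  then show False using p(4) by simp
qed

text \<open>These estimates account for the terms (p - 1) n and p (p - 1)^2 / 4 of the bound on
  \<open>r\<close>.\<close>

lemma small_bounds:
  assumes "\<bar>2 * a\<bar> \<le> int p - 1" "\<bar>\<nu>\<bar> = int n"
  shows "\<bar>2 * (\<nu> * a)\<bar> \<le> int n * (int p - 1)" "4 * a\<^sup>2 \<le> (int p - 1)\<^sup>2"
proof -
  have "\<bar>2 * (\<nu> * a)\<bar> = \<bar>\<nu>\<bar> * \<bar>2 * a\<bar>" by (simp add: abs_mult)
  also have "\<dots> \<le> int n * (int p - 1)" unfolding assms(2) using assms(1) by (intro mult_left_mono) auto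
  finally show "\<bar>2 * (\<nu> * a)\<bar> \<le> int n * (int p - 1)" .
  have "(2 * a)\<^sup>2 \<le> (int p - 1)\<^sup>2" using assms(1) by (intro abs_le_square_iff[THEN iffD1]) linarith
  then show "4 * a\<^sup>2 \<le> (int p - 1)\<^sup>2" by (simp add: power_mult_distrib)
qed

text \<open>With m = (d + n^2) / p, the norm of p a + \<nu> + w is p (p a^2 + 2 \<nu> a + m), and
  p^2 t remains. The first three terms of the bound dominate p a^2, 2 \<nu> a and m; the last one
  leaves t >= 2 d.\<close>

lemma represented_even_discriminant:
  assumes d4: "d mod 4 = 1 \<or> d mod 4 = 2" and n: "(int n ^ 2 + int d) mod int p = 0" and r: "r > 0"
    and C: "real r \<ge> real p * (real p - 1)^2 / 4 + (real p - 1) * real n + (real d + real n ^ 2) / real p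
            + 2 * real p * real d"
  shows "unary_represented_by_I4 OE P (real r / real p)"
proof -
  have p0: "p > 0" using p(1) by (rule prime_gt_0_nat)
  obtain \<nu> where \<nu>: "\<bar>\<nu>\<bar> = int n" "of_int \<nu> + w \<in> P" using exists_signed_root[OF n] by blast
  have \<nu>n: "\<nu>\<^sup>2 = int n ^ 2" using \<nu>(1) by (metis power2_abs)
  obtain m where m: "\<nu>\<^sup>2 + int d = int p * m" using root_dvd[OF \<nu>(2)] by (auto simp: dvd_def)
  have "\<not> int p dvd 2 * \<nu>"
    using not_dvd_root[OF root_dvd[OF \<nu>(2)]] coprime_p(2) by (simp add: coprime_dvd_mult_right_iff coprime_commute)
  then obtain a where a: "int p dvd (int r - m) - 2 * \<nu> * a" "\<bar>2 * a\<bar> \<le> int p - 1"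
    using exists_small_solution p by blast
  then obtain q where q: "(int r - m) - 2 * \<nu> * a = int p * q" by (auto simp: dvd_def)
  define t where "t = q - a\<^sup>2"
  have t: "int p * t = int r - m - 2 * \<nu> * a - int p * a\<^sup>2" using q by (simp add: t_def algebra_simps)
  have "real_of_int (\<nu>\<^sup>2 + int d) = real p * real_of_int m" unfolding m by simp
  then have rm: "(real d + real n ^ 2) / real p = real_of_int m" using p0 unfolding \<nu>n by (simp add: field_simps)
  have "real_of_int (int p * (int p - 1)\<^sup>2 + 4 * ((int p - 1) * int n) + 4 * m + 8 * (int p * int d)) \<le> real_of_int (4 * int r)"
    using C unfolding rm by simp
  then have "int p * (int p - 1)\<^sup>2 + 4 * ((int p - 1) * int n) + 4 * m + 8 * (int p * int d) \<le> 4 * int r"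
    by (simp only: of_int_le_iff)
  moreover have "int p * (4 * a\<^sup>2) \<le> int p * (int p - 1)\<^sup>2"
    using small_bounds(2)[OF a(2) \<nu>(1)] by (intro mult_left_mono) auto
  moreover have "2 * (\<nu> * a) \<le> (int p - 1) * int n" using small_bounds(1)[OF a(2) \<nu>(1)] by (simp add: mult.commute)
  ultimately have "int p * (2 * int d) \<le> int p * t" unfolding t by (simp add: mult.assoc)
  then have "2 * int d \<le> t" using p0 by simp
  then obtain x y z u v where xyz: "t = (x\<^sup>2 + int d * u\<^sup>2) + (y\<^sup>2 + int d * v\<^sup>2) + z\<^sup>2"
    using three_norms_even_discriminant[OF d4] by blast
  show ?thesis
  proof (rule represented_by_norms[OF r])
    show "(of_int (int p * a + \<nu>) + of_int 1 * w) * cnj (of_int (int p * a + \<nu>) + of_int 1 * w) = of_int ((int p * a + \<nu>)\<^sup>2 + int d * 1\<^sup>2)"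
      by (rule norm_quad)
    show "(of_nat p * (of_int x + of_int u * w)) * cnj (of_nat p * (of_int x + of_int u * w)) = of_int ((int p)\<^sup>2 * (x\<^sup>2 + int d * u\<^sup>2))"
      "(of_nat p * (of_int y + of_int v * w)) * cnj (of_nat p * (of_int y + of_int v * w)) = of_int ((int p)\<^sup>2 * (y\<^sup>2 + int d * v\<^sup>2))"
      "(of_nat p * (of_int z + of_int 0 * w)) * cnj (of_nat p * (of_int z + of_int 0 * w)) = of_int ((int p)\<^sup>2 * (z\<^sup>2 + int d * 0\<^sup>2))"
      unfolding norm_scale norm_quad of_int_mult by (rule refl)+
    have "of_int a * of_nat p + (of_int \<nu> + w) \<in> P" by (intro P_add P_int p \<nu>)
    then have "of_int (int p * a + \<nu>) + of_int 1 * w \<in> P" by (simp add: algebra_simps)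
    then show "s \<in> P" if "s \<in> {of_int (int p * a + \<nu>) + of_int 1 * w, of_nat p * (of_int x + of_int u * w),
        of_nat p * (of_int y + of_int v * w), of_nat p * (of_int z + of_int 0 * w)}" for s
      using that P_scale[OF O_quad] by blast
    have "(int p * a + \<nu>)\<^sup>2 + int d * 1\<^sup>2 = int p * (int p * a\<^sup>2 + 2 * \<nu> * a) + (\<nu>\<^sup>2 + int d)"
      by (simp add: power2_eq_square algebra_simps)
    moreover have "(int p)\<^sup>2 * (x\<^sup>2 + int d * u\<^sup>2) + (int p)\<^sup>2 * (y\<^sup>2 + int d * v\<^sup>2) + (int p)\<^sup>2 * (z\<^sup>2 + int d * 0\<^sup>2) = int p * (int p * t)"
      unfolding xyz by (simp add: power2_eq_square algebra_simps)
    ultimately show "(int p * a + \<nu>)\<^sup>2 + int d * 1\<^sup>2 + (int p)\<^sup>2 * (x\<^sup>2 + int d * u\<^sup>2) + (int p)\<^sup>2 * (y\<^sup>2 + int d * v\<^sup>2)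
        + (int p)\<^sup>2 * (z\<^sup>2 + int d * 0\<^sup>2) = int p * int r"
      unfolding m t by (simp add: algebra_simps)
  qed
qed

text \<open>With m = (d + n^2) / (4 p), the norm of p a + (\<nu> + w) / 2 is p (p a^2 + \<nu> a +
  m). The last term of the bound leaves t >= (d + 1) / 4, enough to use x + (1 + w) / 2, whose norm
  is x^2 + x + (d + 1) / 4.\<close>

lemma represented_odd_discriminant:
  assumes d4: "d mod 4 = 3" and n: "odd n" "(int n ^ 2 + int d) mod int p = 0" and r: "r > 0"
    and C: "real r \<ge> real p * (real p - 1)^2 / 4 + (real p - 1) * real n + (real d + real n ^ 2) / real p
            + real p * (real d + 1) / 4"
  shows "unary_represented_by_I4 OE P (real r / real p)"
proof -
  have p0: "p > 0" using p(1) by (rule prime_gt_0_nat)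
  obtain \<nu> where \<nu>: "\<bar>\<nu>\<bar> = int n" "of_int \<nu> + w \<in> P" using exists_signed_root[OF n(2)] by blast
  have \<nu>n: "\<nu>\<^sup>2 = int n ^ 2" using \<nu>(1) by (metis power2_abs)
  have odd: "odd \<nu>" using n(1) \<nu>(1) by (metis dvd_abs_iff even_of_nat)
  obtain k where k: "d = 4 * k + 3" using d4 by (metis mult_div_mod_eq)
  have four: "4 dvd b\<^sup>2 + int d * 1\<^sup>2" if "odd b" for b
  proof -
    obtain c where "b = 2 * c + 1" using \<open>odd b\<close> by (auto elim: oddE)
    then have "b\<^sup>2 + int d * 1\<^sup>2 = 4 * (c\<^sup>2 + c + int k + 1)" unfolding k by (simp add: power2_eq_square algebra_simps)
    then show ?thesis by (metis dvd_triv_left)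
  qed
  have "4 * int p dvd \<nu>\<^sup>2 + int d"
    using four[OF odd] root_dvd[OF \<nu>(2)] coprime_p(1) by (intro divides_mult) auto
  then obtain m where m: "\<nu>\<^sup>2 + int d = 4 * int p * m" by (auto simp: dvd_def)
  have half: "half_quad d \<nu> 1 \<in> P"
  proof -
    obtain h where h: "p = 2 * h + 1" using p(3) by (auto elim: oddE)
    have "half_quad d \<nu> 1 \<in> OE" unfolding O_iff using four[OF odd] by blast
    \<comment> \<open>The element (\<nu> + w) / 2 is 2 (h + 1) - p = 1 times itself, a combination
      of members of \<open>P\<close>.\<close>
    then have "of_int (int h + 1) * (of_int \<nu> + w) - of_nat p * half_quad d \<nu> 1 \<in> P"
      by (intro P_diff P_int \<nu> P_scale)
    also have "of_int (int h + 1) * (of_int \<nu> + w) - of_nat p * half_quad d \<nu> 1 = half_quad d \<nu> 1"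
      unfolding h using half_quad_half[of \<nu> 1] by (simp add: algebra_simps)
    finally show ?thesis .
  qed
  obtain a where a: "int p dvd (int r - m) - \<nu> * a" "\<bar>2 * a\<bar> \<le> int p - 1"
    using exists_small_solution p not_dvd_root[OF root_dvd[OF \<nu>(2)]] by blast
  then obtain q where q: "(int r - m) - \<nu> * a = int p * q" by (auto simp: dvd_def)
  define t where "t = q - a\<^sup>2"
  have t: "int p * t = int r - m - \<nu> * a - int p * a\<^sup>2" using q by (simp add: t_def algebra_simps)
  have "real_of_int (\<nu>\<^sup>2 + int d) = real p * real_of_int (4 * m)" unfolding m by simp
  then have rm: "(real d + real n ^ 2) / real p = real_of_int (4 * m)" using p0 unfolding \<nu>n by (simp add: field_simps)
  have "int p * m \<ge> 0" using m zero_le_power2[of \<nu>] by linarith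
  then have m0: "m \<ge> 0" using p0 by (simp add: zero_le_mult_iff)
  have "real_of_int (int p * (int p - 1)\<^sup>2 + 4 * ((int p - 1) * int n) + 16 * m + int p * (int d + 1)) \<le> real_of_int (4 * int r)"
    using C unfolding rm by simp
  then have "int p * (int p - 1)\<^sup>2 + 4 * ((int p - 1) * int n) + 16 * m + int p * (int d + 1) \<le> 4 * int r"
    by (simp only: of_int_le_iff)
  moreover have "int p * (4 * a\<^sup>2) \<le> int p * (int p - 1)\<^sup>2"
    using small_bounds(2)[OF a(2) \<nu>(1)] by (intro mult_left_mono) auto
  moreover have "2 * (\<nu> * a) \<le> (int p - 1) * int n" "0 \<le> (int p - 1) * int n"
    using small_bounds(1)[OF a(2) \<nu>(1)] p0 by (simp_all add: mult.commute)
  \<comment> \<open>The products are abstracted to variables so that the estimate is linear;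
    \<open>m >= 0\<close> lets 16 m dominate 4 m.\<close>
  moreover have "X \<le> 4 * (R - m - V - W)"
    if "U + 4 * Y + 16 * m + X \<le> 4 * R" "4 * W \<le> U" "2 * V \<le> Y" "0 \<le> Y" for X R V W U Y :: int
    using that m0 unfolding right_diff_distrib by linarith
  moreover have "int p * (4 * a\<^sup>2) = 4 * (int p * a\<^sup>2)" by simp
  ultimately have "int p * (int d + 1) \<le> 4 * (int p * t)" unfolding t by metis
  then have "int p * (int d + 1) \<le> int p * (4 * t)" by simp
  then have "int d + 1 \<le> 4 * t" using p0 by (simp only: mult_le_cancel_left_pos of_nat_0_less_iff)
  then have "t - (int k + 1) \<ge> 0" unfolding k by simp
  then obtain x y z where xyz: "t - (int k + 1) = x\<^sup>2 + x + y\<^sup>2 + z\<^sup>2" using pronic_plus_two_squares by blast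
  have N0: "(2 * int p * a + \<nu>)\<^sup>2 + int d * 1\<^sup>2 = 4 * (int p * (int p * a\<^sup>2 + \<nu> * a + m))"
  proof -
    have "(2 * int p * a + \<nu>)\<^sup>2 + int d * 1\<^sup>2 = 4 * (int p * (int p * a\<^sup>2 + \<nu> * a)) + (\<nu>\<^sup>2 + int d)"
      by (simp add: power2_eq_square algebra_simps)
    then show ?thesis unfolding m by (simp add: algebra_simps)
  qed
  have N1: "(2 * x + 1)\<^sup>2 + int d * 1\<^sup>2 = 4 * (x\<^sup>2 + x + int k + 1)"
    unfolding k by (simp add: power2_eq_square algebra_simps)
  show ?thesis
  proof (rule represented_by_norms[OF r])
    show "half_quad d (2 * int p * a + \<nu>) 1 * cnj (half_quad d (2 * int p * a + \<nu>) 1) = of_int (int p * (int p * a\<^sup>2 + \<nu> * a + m))"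
      by (rule norm_half_quad[OF N0])
    show "(of_nat p * half_quad d (2 * x + 1) 1) * cnj (of_nat p * half_quad d (2 * x + 1) 1) = of_int ((int p)\<^sup>2 * (x\<^sup>2 + x + int k + 1))"
      unfolding norm_scale norm_half_quad[OF N1] of_int_mult by (rule refl)
    show "(of_nat p * (of_int y + of_int 0 * w)) * cnj (of_nat p * (of_int y + of_int 0 * w)) = of_int ((int p)\<^sup>2 * (y\<^sup>2 + int d * 0\<^sup>2))"
      "(of_nat p * (of_int z + of_int 0 * w)) * cnj (of_nat p * (of_int z + of_int 0 * w)) = of_int ((int p)\<^sup>2 * (z\<^sup>2 + int d * 0\<^sup>2))"
      unfolding norm_scale norm_quad of_int_mult by (rule refl)+
    have "of_int a * of_nat p + half_quad d \<nu> 1 \<in> P" by (intro P_add P_int p half)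
    moreover have "of_int a * of_nat p + half_quad d \<nu> 1 = half_quad d (2 * int p * a + \<nu>) 1"
      by (simp add: half_quad_def add_divide_distrib)
    moreover have "half_quad d (2 * x + 1) 1 \<in> OE" unfolding O_iff using four[of "2 * x + 1"] by force
    ultimately show "s \<in> P" if "s \<in> {half_quad d (2 * int p * a + \<nu>) 1, of_nat p * half_quad d (2 * x + 1) 1,
        of_nat p * (of_int y + of_int 0 * w), of_nat p * (of_int z + of_int 0 * w)}" for s
      using that by (auto intro: P_scale O_quad O_of_int)
    have "(int p)\<^sup>2 * (x\<^sup>2 + x + int k + 1) + (int p)\<^sup>2 * (y\<^sup>2 + int d * 0\<^sup>2) + (int p)\<^sup>2 * (z\<^sup>2 + int d * 0\<^sup>2)
        = int p * (int p * ((t - (int k + 1)) + int k + 1))"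
      unfolding xyz by (simp add: power2_eq_square algebra_simps)
    also have "\<dots> = int p * (int p * t)" by simp
    finally show "int p * (int p * a\<^sup>2 + \<nu> * a + m) + (int p)\<^sup>2 * (x\<^sup>2 + x + int k + 1) + (int p)\<^sup>2 * (y\<^sup>2 + int d * 0\<^sup>2)
        + (int p)\<^sup>2 * (z\<^sup>2 + int d * 0\<^sup>2) = int p * int r"
      unfolding t by (simp add: algebra_simps)
  qed
qed

lemma exists_positive_root: "\<exists>n. n > 0 \<and> (int n ^ 2 + int d) mod int p = 0"
proof -
  obtain c where c: "of_int c + w \<in> P" using exists_root_mem by blast
  have "c \<noteq> 0" using not_dvd_root[OF root_dvd[OF c]] by auto
  then show ?thesis using root_dvd[OF c] by (intro exI[of _ "nat \<bar>c\<bar>"]) auto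
qed

text \<open>Adding the odd \<open>p\<close> changes the parity of a root but not its
  residue.\<close>

lemma exists_odd_positive_root: "\<exists>n. n > 0 \<and> odd n \<and> (int n ^ 2 + int d) mod int p = 0"
proof -
  obtain n where n: "n > 0" "(int n ^ 2 + int d) mod int p = 0" using exists_positive_root by (elim exE conjE)
  show ?thesis
  proof (cases "odd n")
    case False
    have "int (n + p) ^ 2 + int d = (int n ^ 2 + int d) + int p * (2 * int n + int p)"
      by (simp add: power2_eq_square algebra_simps)
    then have "(int (n + p) ^ 2 + int d) mod int p = 0" using n(2) by (simp only: mod_mult_self2)
    moreover have "n + p > 0" "odd (n + p)" using False n(1) p(3) by simp_all
    ultimately show ?thesis by (intro exI[of _ "n + p"] conjI)
  qed (intro exI[of _ n] conjI n)
qed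

end

section \<open>The theorem, by the residue of d modulo 4\<close>

theorem theorem3:
  fixes d p r :: nat and P :: "complex set"
  assumes "d > 0" and "squarefree d"
    and "class_number d \<ge> 4"
    and "prime_ideal (ring_of_integers d) P"
    and "\<not> principal_ideal (ring_of_integers d) P"
    and "prime p" and "of_nat p \<in> P"
    and "odd p" and "\<not> p dvd d"
    and "r > 0"
    and "real r \<ge>
      (if d mod 4 = 3 then
         (let n = (LEAST n :: nat. n > 0 \<and> odd n \<and> (int n ^ 2 + int d) mod int p = 0) in
            real p * (real p - 1)^2 / 4 + (real p - 1) * real n + (real d + real n ^ 2) / real p
            + real p * (real d + 1) / 4)
       else
         (let n = (LEAST n :: nat. n > 0 \<and> (int n ^ 2 + int d) mod int p = 0) in
            real p * (real p - 1)^2 / 4 + (real p - 1) * real n + (real d + real n ^ 2) / real p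
            + 2 * real p * real d))"
  shows "unary_represented_by_I4 (ring_of_integers d) P (real r / real p)"
proof -
  interpret split_prime_ideal d p P using assms by unfold_locales
  show ?thesis
  proof (cases "d mod 4 = 3")
    case True
    define n where "n = (LEAST n :: nat. n > 0 \<and> odd n \<and> (int n ^ 2 + int d) mod int p = 0)"
    have "n > 0 \<and> odd n \<and> (int n ^ 2 + int d) mod int p = 0"
      unfolding n_def by (rule LeastI_ex[OF exists_odd_positive_root])
    then show ?thesis
      using represented_odd_discriminant[OF True _ _ assms(10), of n] assms(11) True
      unfolding Let_def n_def[symmetric] by simp
  next
    case False
    define n where "n = (LEAST n :: nat. n > 0 \<and> (int n ^ 2 + int d) mod int p = 0)"
    have n: "n > 0 \<and> (int n ^ 2 + int d) mod int p = 0"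
      unfolding n_def by (rule LeastI_ex[OF exists_positive_root])
    have "\<not> 2 ^ 2 dvd d" using assms(2) unfolding squarefree_def by (metis nat_dvd_1_iff_1 numeral_eq_one_iff semiring_norm(85))
    then have "d mod 4 = 1 \<or> d mod 4 = 2" using False by simp presburger
    then show ?thesis
      using represented_even_discriminant[OF _ _ assms(10), of n] assms(11) False n
      unfolding Let_def n_def[symmetric] by simp
  qed
qed

end
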